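(* Let $(G,\mathbf p)$ be a framework (with $\mathbf p$ pinned) with $\dim(K)=1$. Suppose that for some integer $k\ge 2$, $(G,\mathbf p)$ has a $(1,k-1)$-flex but no $(1,k)$-flex. Then $(G,\mathbf p)$ is rigid and its rigidity order is $k$. Moreover, if $(G,\mathbf p)$ has a $(1,k)$-flex, then either it is flexible, or it is rigid with rigidity order at least $k+1$.
   Context: Fix a dimension $d$. A configuration is $\mathbf p=(\mathbf p_1,\dots,\mathbf p_n)$ with $\mathbf p_i\in\mathbb R^d$; a framework $(G,\mathbf p)$ consists of a graph $G$ on $\{1,\dots,n\}$ and a configuration, with $\mathbf p_i\neq \mathbf p_j$ for every edge $ij$. $(G,\mathbf q)$ is equivalent to $(G,\mathbf p)$ if $|\mathbf q_i-\mathbf q_j|=|\mathbf p_i-\mathbf p_j|$ for all edges $ij$. A configuration $\mathbf q$ is in $\ell$-pinned position if $\mathbf q_1=0$ and, for $2\le i\le \ell+1$, $\mathbf q_i$ lies in the span of $e_1,\dots,e_{i-1}$; these form a linear space ($\ell$-pinned configuration space). If $\mathbf p$ has $\ell$-dimensional affine span, it is pinned if $\mathbf p_1,\dots,\mathbf p_{\ell+1}$ are affinely independent and $\mathbf p$ is in $\ell$-pinned position. Throughout, $\mathbf p$ is pinned with $\ell$-dimensional affine span and all configurations, trajectories and flexes are $\ell$-pinned. $(G,\mathbf p)$ is rigid if there is a neighborhood $U$ of $\mathbf p$ such that every $\ell$-pinned $\mathbf q\in U$ with $(G,\mathbf q)$ equivalent to $(G,\mathbf p)$ equals $\mathbf p$;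 otherwise flexible. A trajectory at $\mathbf p$ is an analytic non-constant map $t\mapsto \mathbf p(t)$ into $\ell$-pinned configuration space, defined for $t\in[0,\varepsilon]$, $\varepsilon>0$, with $\mathbf p(0)=\mathbf p$. A $C^k$ function $\varphi(t)$ is $k$-vanishing if $\varphi^{(i)}(0)=0$ for $1\le i\le k$, and $k$-active if it is $(k-1)$-vanishing but not $k$-vanishing. Let $\mathbf m(\mathbf q)=(|\mathbf q_i-\mathbf q_j|^2)_{ij\in E(G)}$. For integers $j,k\ge1$, a $(j,k)$-flex of $(G,\mathbf p)$ is a $j$-active trajectory $\mathbf p(t)$ at $\mathbf p$ with $\mathbf m(\mathbf p(t))$ $k$-vanishing. $K$ denotes the linear space of $\ell$-pinned $\mathbf p'$ with $(\mathbf p_v-\mathbf p_w)\cdot(\mathbf p'_v-\mathbf p'_w)=0$ for every edge $vw$ (equivalently, $0$ together with all $\mathbf p'$ such that $\mathbf p+\mathbf p't$ is a $(1,1)$-flex). A stiff-bar energy at $\mathbf p$ is $E(\mathbf q)=\sum_{ij\in E(G)}E_{ij}(|\mathbf q_i-\mathbf q_j|)$ on $\ell$-pinned configurations, where each $E_{ij}$ is analytic at $d_{ij}=|\mathbf p_i-\mathbf p_j|\neq0$, has a strict local minimum at $d_{ij}$, and $E_{ij}''(d_{ij})>0$. For $E$ with a local minimum at $\mathbf p$ and $s>0$: $E$ grows always-$s$-quickly at $\mathbf p$ if there are $c_1>0$ and a neighborhood $U$ of $\mathbf p$ with $E(\mathbf q)-E(\mathbf p)\ge c_1|\mathbf q-\mathbf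 p|^s$ on $U$; sometimes-$s$-slowly if there are a trajectory $\mathbf p(t)$ at $\mathbf p$ and $c_2,\delta>0$ with $E(\mathbf p(t))-E(\mathbf p)\le c_2|\mathbf p(t)-\mathbf p|^s$ for $t\in[0,\delta]$; $s$ is the tight growth order if both hold. For a rigid framework, all stiff-bar energies at $\mathbf p$ have the same rational tight growth order $s$, and the rigidity order of $(G,\mathbf p)$ is $\nu=s/2$. *)

theory Defs
  imports "HOL-Analysis.Analysis"
begin

text \<open>Frameworks: vertices are the elements of a finite linearly ordered type 'v
  (the k-th vertex is the one of index k-1), coordinates of R^d are the elements of
  a finite linearly ordered type 'd (the k-th standard basis vector e_k is the axis of
  the coordinate of index k-1).  A configuration is p :: real^'d^'v.
  Edges are pairs (v,w) with v < w.\<close>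

definition idx :: "'a::{finite,linorder} \<Rightarrow> nat" where
  "idx x = card {y. y < x}"

text \<open>The l-pinned configuration space: vertex 1 at the origin and vertex i (2 <= i <= l+1)
  in the span of e_1..e_{i-1}; 0-based: vertex of index i <= l has all coordinates of
  index >= i equal to 0.\<close>
definition pinned_space :: "nat \<Rightarrow> (real^'d::{finite,linorder}^'v::{finite,linorder}) set" where
  "pinned_space l = {q. \<forall>v c. idx v \<le> l \<and> idx c \<ge> idx v \<longrightarrow> q $ v $ c = 0}"

definition framework :: "('v::{finite,linorder} \<times> 'v::{finite,linorder}) set \<Rightarrow> real^'d::{finite,linorder}^'v::{finite,linorder} \<Rightarrow> bool" where
  "framework E p \<longleftrightarrow> (\<forall>(v,w)\<in>E. v < w \<and> p $ v \<noteq> p $ w)"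

definition pinned :: "nat \<Rightarrow> real^'d::{finite,linorder}^'v::{finite,linorder} \<Rightarrow> bool" where
  "pinned l p \<longleftrightarrow> aff_dim (range (\<lambda>v. p $ v)) = int l
     \<and> inj_on (\<lambda>v. p $ v) {v. idx v \<le> l}
     \<and> \<not> affine_dependent ((\<lambda>v. p $ v) ` {v. idx v \<le> l})
     \<and> p \<in> pinned_space l"

definition equivalent :: "('v::{finite,linorder} \<times> 'v::{finite,linorder}) set \<Rightarrow> real^'d::{finite,linorder}^'v::{finite,linorder} \<Rightarrow> real^'d::{finite,linorder}^'v::{finite,linorder} \<Rightarrow> bool" where
  "equivalent E p q \<longleftrightarrow> (\<forall>(v,w)\<in>E. dist (q $ v) (q $ w) = dist (p $ v) (p $ w))"

definition rigid :: "nat \<Rightarrow> ('v::{finite,linorder} \<times> 'v::{finite,linorder}) set \<Rightarrow> real^'d::{finite,linorder}^'v::{finite,linorder} \<Rightarrow> bool" where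
  "rigid l E p \<longleftrightarrow> (\<exists>U. open U \<and> p \<in> U \<and>
      (\<forall>q \<in> U \<inter> pinned_space l. equivalent E p q \<longrightarrow> q = p))"

definition real_analytic_at :: "(real \<Rightarrow> real) \<Rightarrow> real \<Rightarrow> bool" where
  "real_analytic_at f x \<longleftrightarrow> (\<exists>r>0. \<exists>a::nat \<Rightarrow> real.
      \<forall>y. \<bar>y - x\<bar> < r \<longrightarrow> (\<lambda>k. a k * (y - x) ^ k) sums f y)"

definition trajectory :: "nat \<Rightarrow> real^'d::{finite,linorder}^'v::{finite,linorder}
    \<Rightarrow> (real \<Rightarrow> real^'d::{finite,linorder}^'v::{finite,linorder}) \<Rightarrow> real \<Rightarrow> bool" where
  "trajectory l p P eps \<longleftrightarrow> eps > 0 \<and> P 0 = p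
     \<and> (\<forall>t\<in>{0..eps}. P t \<in> pinned_space l)
     \<and> (\<forall>t\<in>{0..eps}. \<forall>v c. real_analytic_at (\<lambda>s. P s $ v $ c) t)
     \<and> (\<exists>t\<in>{0..eps}. P t \<noteq> p)"

definition vanishing :: "(real \<Rightarrow> real) \<Rightarrow> nat \<Rightarrow> bool" where
  "vanishing f k \<longleftrightarrow> (\<forall>i. 1 \<le> i \<and> i \<le> k \<longrightarrow> (deriv ^^ i) f 0 = 0)"

definition traj_active :: "(real \<Rightarrow> real^'d::{finite,linorder}^'v::{finite,linorder}) \<Rightarrow> nat \<Rightarrow> bool" where
  "traj_active P j \<longleftrightarrow> (\<forall>v c. vanishing (\<lambda>t. P t $ v $ c) (j - 1))
     \<and> \<not> (\<forall>v c. vanishing (\<lambda>t. P t $ v $ c) j)"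

definition is_flex :: "nat \<Rightarrow> ('v::{finite,linorder} \<times> 'v::{finite,linorder}) set \<Rightarrow> real^'d::{finite,linorder}^'v::{finite,linorder}
    \<Rightarrow> nat \<Rightarrow> nat \<Rightarrow> (real \<Rightarrow> real^'d::{finite,linorder}^'v::{finite,linorder}) \<Rightarrow> bool" where
  "is_flex l E p j k P \<longleftrightarrow> (\<exists>eps. trajectory l p P eps) \<and> traj_active P j
     \<and> (\<forall>(v,w)\<in>E. vanishing (\<lambda>t. (norm (P t $ v - P t $ w))\<^sup>2) k)"

definition has_flex :: "nat \<Rightarrow> ('v::{finite,linorder} \<times> 'v::{finite,linorder}) set \<Rightarrow> real^'d::{finite,linorder}^'v::{finite,linorder}
    \<Rightarrow> nat \<Rightarrow> nat \<Rightarrow> bool" where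
  "has_flex l E p j k \<longleftrightarrow> (\<exists>P. is_flex l E p j k P)"

definition Kspace :: "nat \<Rightarrow> ('v::{finite,linorder} \<times> 'v::{finite,linorder}) set \<Rightarrow> real^'d::{finite,linorder}^'v::{finite,linorder}
    \<Rightarrow> (real^'d::{finite,linorder}^'v::{finite,linorder}) set" where
  "Kspace l E p = {p'. p' \<in> pinned_space l \<and>
      (\<forall>(v,w)\<in>E. (p $ v - p $ w) \<bullet> (p' $ v - p' $ w) = 0)}"

definition stiff_bar :: "('v::{finite,linorder} \<times> 'v::{finite,linorder}) set \<Rightarrow> real^'d::{finite,linorder}^'v::{finite,linorder} \<Rightarrow> ('v::{finite,linorder} \<times> 'v::{finite,linorder} \<Rightarrow> real \<Rightarrow> real) \<Rightarrow> bool" where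
  "stiff_bar E p F \<longleftrightarrow> (\<forall>(v,w)\<in>E. let d = dist (p $ v) (p $ w) in
      real_analytic_at (F (v,w)) d
      \<and> (\<exists>\<delta>>0. \<forall>x. x \<noteq> d \<and> \<bar>x - d\<bar> < \<delta> \<longrightarrow> F (v,w) d < F (v,w) x)
      \<and> (deriv ^^ 2) (F (v,w)) d > 0)"

definition energy :: "('v::{finite,linorder} \<times> 'v::{finite,linorder}) set \<Rightarrow> ('v::{finite,linorder} \<times> 'v::{finite,linorder} \<Rightarrow> real \<Rightarrow> real) \<Rightarrow> real^'d::{finite,linorder}^'v::{finite,linorder} \<Rightarrow> real" where
  "energy E F q = (\<Sum>(v,w)\<in>E. F (v,w) (dist (q $ v) (q $ w)))"

definition local_min_at :: "nat \<Rightarrow> (real^'d::{finite,linorder}^'v::{finite,linorder} \<Rightarrow> real)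
    \<Rightarrow> real^'d::{finite,linorder}^'v::{finite,linorder} \<Rightarrow> bool" where
  "local_min_at l En p \<longleftrightarrow> (\<exists>U. open U \<and> p \<in> U \<and> (\<forall>q \<in> U \<inter> pinned_space l. En p \<le> En q))"

definition always_quick :: "nat \<Rightarrow> (real^'d::{finite,linorder}^'v::{finite,linorder} \<Rightarrow> real)
    \<Rightarrow> real^'d::{finite,linorder}^'v::{finite,linorder} \<Rightarrow> real \<Rightarrow> bool" where
  "always_quick l En p s \<longleftrightarrow> (\<exists>c1>0. \<exists>U. open U \<and> p \<in> U \<and>
      (\<forall>q \<in> U \<inter> pinned_space l. En q - En p \<ge> c1 * norm (q - p) powr s))"

definition sometimes_slow :: "nat \<Rightarrow> (real^'d::{finite,linorder}^'v::{finite,linorder} \<Rightarrow> real)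
    \<Rightarrow> real^'d::{finite,linorder}^'v::{finite,linorder} \<Rightarrow> real \<Rightarrow> bool" where
  "sometimes_slow l En p s \<longleftrightarrow> (\<exists>P eps. trajectory l p P eps \<and> (\<exists>c2>0. \<exists>\<delta>>0. \<delta> \<le> eps \<and>
      (\<forall>t\<in>{0..\<delta>}. En (P t) - En p \<le> c2 * norm (P t - p) powr s)))"

definition tight_growth :: "nat \<Rightarrow> (real^'d::{finite,linorder}^'v::{finite,linorder} \<Rightarrow> real)
    \<Rightarrow> real^'d::{finite,linorder}^'v::{finite,linorder} \<Rightarrow> real \<Rightarrow> bool" where
  "tight_growth l En p s \<longleftrightarrow> s > 0 \<and> local_min_at l En p
     \<and> always_quick l En p s \<and> sometimes_slow l En p s"

definition has_rigidity_order :: "nat \<Rightarrow> ('v::{finite,linorder} \<times> 'v::{finite,linorder}) set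
    \<Rightarrow> real^'d::{finite,linorder}^'v::{finite,linorder} \<Rightarrow> real \<Rightarrow> bool" where
  "has_rigidity_order l E p \<nu> \<longleftrightarrow> rigid l E p \<and>
     (\<forall>F. stiff_bar E p F \<longrightarrow> tight_growth l (energy E F) p (2 * \<nu>))"

end

theory Submission
  imports Defs
begin

text \<open>
  Near \<open>p\<close> every stiff-bar energy is comparable to \<open>|m(q) - m(p)|^2\<close>, so the rigidity order is the
  growth order of the quadratic map \<open>m\<close>.  A \<open>(1, k - 1)\<close>-flex \<open>P\<close> satisfies
  \<open>m(P t) = m(p) + t^k r + o(t^k)\<close>, and \<open>r\<close> lies outside the image of the differential of \<open>m\<close> at
  \<open>p\<close> unless a correction \<open>P t + t^k w\<close> is a \<open>(1, k)\<close>-flex.  Since \<open>K\<close> is the line spanned by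
  \<open>u = P'(0)\<close>, the intermediate value theorem writes each \<open>q\<close> near \<open>p\<close> as \<open>P t + w\<close> with \<open>w\<close>
  orthogonal to \<open>u\<close>.  The linear map \<open>(s, w) \<mapsto> s r + dm w\<close> is injective on such pairs, so
  \<open>|m(q) - m(p)|\<close> is at least a multiple of \<open>|t|^k + |w|\<close>, hence of \<open>|q - p|^k\<close>.  Conversely, along
  a \<open>(1, k)\<close>-flex the energy is \<open>O(t^(2k+2))\<close> while the distance to \<open>p\<close> is of order \<open>t\<close>.
\<close>

section \<open>Real-analytic functions of one variable\<close>

text \<open>Each differentiation replaces the series by \<open>fps_deriv F\<close>, whose
  coefficient at n is n + 1 times that of F at n + 1; these factors build up the factorial. This is
  how the derivatives in \<open>vanishing\<close> become Taylor coefficients.\<close>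

lemma higher_deriv_has_fps_expansion:
  fixes f :: "'a::{banach,real_normed_field} \<Rightarrow> 'a"
  assumes "f has_fps_expansion F"
  shows "(deriv ^^ n) f 0 = fact n * fps_nth F n"
  using assms
proof (induction n arbitrary: f F)
  case 0
  then show ?case
    unfolding has_fps_expansion_def using eventually_nhds_x_imp_x[of "\<lambda>z. eval_fps F z = f z" 0]
    by (auto simp: eval_fps_at_0)
next
  case (Suc n)
  have "(deriv ^^ Suc n) f 0 = (deriv ^^ n) (deriv f) 0"
    by (simp add: funpow_swap1)
  also have "\<dots> = fact n * fps_nth (fps_deriv F) n"
    by (rule Suc.IH) (intro has_fps_expansion_deriv Suc.prems)
  finally show ?case
    by (simp add: algebra_simps)
qed

lemma has_fps_expansion_at_0:
  fixes f :: "'a::{banach,real_normed_field} \<Rightarrow> 'a"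
  assumes "f has_fps_expansion F"
  shows "f 0 = fps_nth F 0"
  using higher_deriv_has_fps_expansion[OF assms, of 0] by simp

text \<open>The quotient, given the value \<open>fps_nth F n\<close> at 0, has the expansion
  \<open>fps_shift n F\<close> and is therefore continuous at 0. The zero series is treated apart:
  its \<open>subdegree\<close> is 0 by convention, so the bound n \<le> \<open>subdegree F\<close>
  may fail.\<close>

lemma has_fps_expansion_tendsto_divide_power:
  fixes f :: "'a::{banach,real_normed_field} \<Rightarrow> 'a"
  assumes "f has_fps_expansion F" and "\<And>i. i < n \<Longrightarrow> fps_nth F i = 0"
  shows "((\<lambda>x. f x / x ^ n) \<longlongrightarrow> fps_nth F n) (at 0)"
proof (cases "F = 0")
  case True
  have "eventually (\<lambda>x. f x = 0) (at 0)"
    using assms(1) True unfolding has_fps_expansion_def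
    by (auto intro: eventually_at_filter[THEN iffD2] elim: eventually_mono)
  then have "eventually (\<lambda>x. f x / x ^ n = fps_nth F n) (at 0)"
    by eventually_elim (simp add: True)
  then show ?thesis by (rule tendsto_eventually)
next
  case False
  let ?g = "\<lambda>x. if x = 0 then fps_nth F n else f x / x ^ n"
  have "n \<le> subdegree F"
    using assms(2) False by (intro subdegree_geI) auto
  then have "?g has_fps_expansion fps_shift n F"
    by (intro has_fps_expansion_shift assms refl)
  from has_fps_expansion_imp_continuous[OF this, of UNIV]
  have "(?g \<longlongrightarrow> fps_nth F n) (at 0)"
    by (simp add: isCont_def)
  then show ?thesis
    by (rule Lim_transform_eventually) (auto simp: eventually_at_filter)
qed

text \<open>Translating by x moves the power series to the origin, so that analyticity inherits the
  closure properties of \<open>has_fps_expansion\<close>. In the converse, the positive convergence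
  radius turns \<open>eval_fps\<close> back into a convergent sum.\<close>

lemma real_analytic_at_iff_has_fps_expansion:
  "real_analytic_at f x \<longleftrightarrow> (\<exists>F. (\<lambda>t. f (x + t)) has_fps_expansion F)"
proof
  assume "real_analytic_at f x"
  then obtain r a where r: "r > 0"
    and a: "\<And>y. \<bar>y - x\<bar> < r \<Longrightarrow> (\<lambda>k. a k * (y - x) ^ k) sums f y"
    unfolding real_analytic_at_def by auto
  have "eventually (\<lambda>t. \<bar>t\<bar> < r) (nhds (0::real))"
    using r by (auto simp: eventually_nhds_metric dist_real_def)
  then have "eventually (\<lambda>t. (\<lambda>n. fps_nth (Abs_fps a) n * t ^ n) sums f (x + t)) (nhds 0)"
  proof eventually_elim
    case (elim t)
    then show ?case using a[of "x + t"] by simp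
  qed
  then have "(\<lambda>t. f (x + t)) has_fps_expansion Abs_fps a"
    by (rule has_fps_expansionI)
  then show "\<exists>F. (\<lambda>t. f (x + t)) has_fps_expansion F"
    by (rule exI)
next
  assume "\<exists>F. (\<lambda>t. f (x + t)) has_fps_expansion F"
  then obtain F where F: "fps_conv_radius F > 0"
      "eventually (\<lambda>t. eval_fps F t = f (x + t)) (nhds 0)"
    unfolding has_fps_expansion_def by blast
  have "eventually (\<lambda>t. t \<in> eball 0 (fps_conv_radius F)) (nhds (0::real))"
    using F by (intro eventually_nhds_in_open) (auto simp: zero_ereal_def)
  with F(2) have "eventually (\<lambda>t. (\<lambda>k. fps_nth F k * t ^ k) sums f (x + t)) (nhds 0)"
    by eventually_elim (metis dist_0_norm in_eball_iff sums_eval_fps)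
  then obtain r where "r > 0" and r: "\<And>t. \<bar>t\<bar> < r \<Longrightarrow> (\<lambda>k. fps_nth F k * t ^ k) sums f (x + t)"
    unfolding eventually_nhds_metric dist_real_def by auto
  have "(\<lambda>k. fps_nth F k * (y - x) ^ k) sums f y" if "\<bar>y - x\<bar> < r" for y
    using r[OF that] by simp
  then show "real_analytic_at f x"
    unfolding real_analytic_at_def using \<open>r > 0\<close> by blast
qed

lemma real_analytic_at_0_iff_has_fps_expansion:
  "real_analytic_at f 0 \<longleftrightarrow> (\<exists>F. f has_fps_expansion F)"
  using real_analytic_at_iff_has_fps_expansion[of f 0] by simp

section \<open>Closure of pointwise analyticity under algebraic operations\<close>

lemma real_analytic_at_add:
  assumes "real_analytic_at f x" "real_analytic_at g x"
  shows "real_analytic_at (\<lambda>t. f t + g t) x"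
  using assms unfolding real_analytic_at_iff_has_fps_expansion
  by (elim exE) (rule exI, erule (1) has_fps_expansion_add)

lemma real_analytic_at_diff:
  assumes "real_analytic_at f x" "real_analytic_at g x"
  shows "real_analytic_at (\<lambda>t. f t - g t) x"
  using assms unfolding real_analytic_at_iff_has_fps_expansion
  by (elim exE) (rule exI, erule (1) has_fps_expansion_diff)

lemma real_analytic_at_mult:
  assumes "real_analytic_at f x" "real_analytic_at g x"
  shows "real_analytic_at (\<lambda>t. f t * g t) x"
  using assms unfolding real_analytic_at_iff_has_fps_expansion
  by (elim exE) (rule exI, erule (1) has_fps_expansion_mult)

lemma real_analytic_at_sum:
  assumes "\<And>i. i \<in> I \<Longrightarrow> real_analytic_at (f i) x"
  shows "real_analytic_at (\<lambda>t. \<Sum>i\<in>I. f i t) x"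
proof -
  obtain F where "\<And>i. i \<in> I \<Longrightarrow> (\<lambda>t. f i (x + t)) has_fps_expansion F i"
    using assms unfolding real_analytic_at_iff_has_fps_expansion by metis
  then have "(\<lambda>t. \<Sum>i\<in>I. f i (x + t)) has_fps_expansion sum F I"
    by (rule has_fps_expansion_sum)
  then show ?thesis
    unfolding real_analytic_at_iff_has_fps_expansion by (rule exI)
qed

lemma real_analytic_at_const: "real_analytic_at (\<lambda>t. c) x"
  unfolding real_analytic_at_iff_has_fps_expansion by (blast intro: has_fps_expansion_const)

lemma real_analytic_at_ident: "real_analytic_at (\<lambda>t. t) x"
  unfolding real_analytic_at_iff_has_fps_expansion
  by (rule exI, rule has_fps_expansion_add[OF has_fps_expansion_const has_fps_expansion_fps_X])

lemma real_analytic_at_power: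
  assumes "real_analytic_at f x"
  shows "real_analytic_at (\<lambda>t. f t ^ n) x"
  by (induction n) (simp_all add: real_analytic_at_mult real_analytic_at_const assms)

lemmas real_analytic_intros = real_analytic_at_add real_analytic_at_diff real_analytic_at_mult
  real_analytic_at_sum real_analytic_at_const real_analytic_at_ident real_analytic_at_power

section \<open>Vanishing derivatives expressed by limits of quotients\<close>

lemma vanishing_iff_fps_nth:
  assumes "f has_fps_expansion F"
  shows "vanishing f k \<longleftrightarrow> (\<forall>i. 1 \<le> i \<and> i \<le> k \<longrightarrow> fps_nth F i = 0)"
  unfolding vanishing_def higher_deriv_has_fps_expansion[OF assms] by simp

text \<open>Subtracting \<open>f 0\<close> kills the constant coefficient and k-vanishing kills
  those of degree 1 to k, so the quotient by the next power converges to the coefficient of degree k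
  + 1.\<close>

lemma vanishing_imp_tendsto:
  assumes "real_analytic_at f 0" and "vanishing f k"
  obtains r where "((\<lambda>t. (f t - f 0) / t ^ Suc k) \<longlongrightarrow> r) (at 0)"
proof -
  obtain F where F: "f has_fps_expansion F"
    using assms(1) real_analytic_at_0_iff_has_fps_expansion by blast
  have "(\<lambda>t. f t - f 0) has_fps_expansion F - fps_const (f 0)"
    by (intro has_fps_expansion_diff F has_fps_expansion_const)
  moreover have "fps_nth (F - fps_const (f 0)) i = 0" if "i < Suc k" for i
    using assms(2) that unfolding vanishing_iff_fps_nth[OF F]
    by (cases "i = 0") (auto simp: has_fps_expansion_at_0[OF F])
  ultimately show thesis
    by (rule that[OF has_fps_expansion_tendsto_divide_power])
qed

text \<open>Strong induction on the degree i: once all lower coefficients are 0, the i-th one is the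
  limit of \<open>(f t - f 0) / t ^ i\<close>. That quotient is the assumed null quotient times
  \<open>t ^ (k - i)\<close>, so its limit is 0.\<close>

lemma tendsto_imp_vanishing:
  assumes "real_analytic_at f 0" and "((\<lambda>t. (f t - f 0) / t ^ k) \<longlongrightarrow> 0) (at 0)"
  shows "vanishing f k"
proof -
  obtain F where F: "f has_fps_expansion F"
    using assms(1) real_analytic_at_0_iff_has_fps_expansion by blast
  let ?G = "F - fps_const (f 0)"
  have G: "(\<lambda>t. f t - f 0) has_fps_expansion ?G"
    by (intro has_fps_expansion_diff F has_fps_expansion_const)
  have "fps_nth ?G i = 0" if "i \<le> k" for i
    using that
  proof (induction i rule: less_induct)
    case (less i)
    have "((\<lambda>t. (f t - f 0) / t ^ i) \<longlongrightarrow> fps_nth ?G i) (at 0)"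
      using less by (intro has_fps_expansion_tendsto_divide_power G) auto
    moreover have "((\<lambda>t. (f t - f 0) / t ^ i) \<longlongrightarrow> 0) (at 0)"
    proof -
      have "((\<lambda>t::real. (f t - f 0) / t ^ k * t ^ (k - i)) \<longlongrightarrow> 0 * 0 ^ (k - i)) (at 0)"
        by (intro tendsto_intros assms(2))
      then have "((\<lambda>t::real. (f t - f 0) / t ^ k * t ^ (k - i)) \<longlongrightarrow> 0) (at 0)"
        by simp
      then show ?thesis
      proof (rule Lim_transform_eventually)
        show "eventually (\<lambda>t. (f t - f 0) / t ^ k * t ^ (k - i) = (f t - f 0) / t ^ i) (at 0)"
          unfolding eventually_at_filter
          using \<open>i \<le> k\<close> by (auto simp: field_simps simp flip: power_add)
      qed
    qed
    ultimately show ?case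
      using tendsto_unique by (metis at_neq_bot)
  qed
  then show ?thesis
    unfolding vanishing_iff_fps_nth[OF F] by (auto simp: fps_eq_iff)
qed

text \<open>Inside the disc of convergence the sum is continuous, and agreement with f near 0 also
  means agreement near each t close to 0. This yields continuity at small negative times, where a
  trajectory carries no hypothesis of its own.\<close>

lemma real_analytic_at_continuous_near:
  assumes "real_analytic_at f x"
  shows "eventually (\<lambda>t. isCont f t) (nhds x)"
proof -
  obtain F where F: "fps_conv_radius F > 0"
      "eventually (\<lambda>t. eval_fps F t = f (x + t)) (nhds 0)"
    using assms unfolding real_analytic_at_iff_has_fps_expansion has_fps_expansion_def by blast
  have "eventually (\<lambda>t. t \<in> eball 0 (fps_conv_radius F)) (nhds (0::real))"
    using F by (intro eventually_nhds_in_open) (auto simp: zero_ereal_def)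
  moreover have "eventually (\<lambda>t. eventually (\<lambda>s. eval_fps F s = f (x + s)) (nhds t)) (nhds 0)"
    using F(2) by (simp add: eventually_eventually)
  ultimately have "eventually (\<lambda>t. isCont (\<lambda>s. f (x + s)) t) (nhds 0)"
  proof eventually_elim
    case (elim t)
    have "isCont (eval_fps F) t"
      using elim(1) continuous_on_eval_fps[of F] open_eball
      by (metis continuous_on_eq_continuous_at)
    then show ?case
      using isCont_cong[OF elim(2)] by blast
  qed
  then obtain e where e: "e > 0" "\<And>t. dist t 0 < e \<Longrightarrow> isCont (\<lambda>s. f (x + s)) t"
    unfolding eventually_nhds_metric by blast
  have "isCont f s" if "dist s x < e" for s
  proof -
    have "isCont (\<lambda>s. f (x + s)) (s - x)"
      using that by (intro e) (simp add: dist_real_def)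
    then have "isCont (\<lambda>u. f (x + (u - x))) s"
      by (intro isCont_o2[where f = "\<lambda>u. u - x" and g = "\<lambda>s. f (x + s)"] continuous_intros)
    then show ?thesis by simp
  qed
  then show ?thesis
    using e(1) unfolding eventually_nhds_metric by blast
qed

text \<open>A nonzero series behaves like its lowest-order term, so it cannot vanish on a one-sided
  neighbourhood.\<close>
lemma real_analytic_at_zero_right_imp_zero:
  assumes "real_analytic_at f 0" and "eps > 0" and zero: "\<And>t. t \<in> {0..eps} \<Longrightarrow> f t = 0"
  shows "eventually (\<lambda>t. f t = 0) (nhds 0)"
proof -
  obtain F where F: "f has_fps_expansion F"
    using assms(1) real_analytic_at_0_iff_has_fps_expansion by blast
  have "F = 0"
  proof (rule ccontr)
    assume "F \<noteq> 0"
    let ?n = "subdegree F"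
    have "((\<lambda>x. f x / x ^ ?n) \<longlongrightarrow> fps_nth F ?n) (at 0)"
      by (intro has_fps_expansion_tendsto_divide_power F) (auto intro: nth_less_subdegree_zero)
    then have "((\<lambda>x. f x / x ^ ?n) \<longlongrightarrow> fps_nth F ?n) (at_right 0)"
      by (rule tendsto_mono[OF at_le, rotated]) auto
    moreover have "eventually (\<lambda>x. f x / x ^ ?n = 0) (at_right 0)"
      using \<open>eps > 0\<close> by (auto simp: eventually_at_right_field zero intro!: exI[of _ eps])
    ultimately have "fps_nth F ?n = 0"
      by (intro tendsto_unique[OF trivial_limit_at_right_real _ tendsto_eventually])
    with \<open>F \<noteq> 0\<close> show False by simp
  qed
  with F show ?thesis
    unfolding has_fps_expansion_def by (auto elim: eventually_mono)
qed

section \<open>Growth of quadratic maps with one-dimensional kernel\<close>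

lemma power_add_le_two_power_mult:
  fixes x y :: real
  assumes "0 \<le> x" "0 \<le> y"
  shows "(x + y) ^ k \<le> 2 ^ k * (x ^ k + y ^ k)"
proof -
  have "(x + y) ^ k \<le> (2 * max x y) ^ k"
    using assms by (intro power_mono) auto
  also have "\<dots> = 2 ^ k * max x y ^ k"
    by (simp add: power_mult_distrib)
  also have "max x y ^ k \<le> x ^ k + y ^ k"
    using assms by (auto simp: max_def)
  finally show ?thesis by simp
qed

text \<open>The limit as an explicit little-o bound. The conditions \<open>f 0 = 0\<close> and
  \<open>n > 0\<close> extend it to t = 0, a parameter that the intermediate value theorem may later
  return.\<close>

lemma eventually_norm_remainder_le:
  fixes f :: "real \<Rightarrow> 'a::real_normed_vector"
  assumes "((\<lambda>t. (1 / t ^ n) *\<^sub>R f t) \<longlongrightarrow> r) (at 0)" and "e > 0" and "f 0 = 0" and "n > 0"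
  shows "eventually (\<lambda>t. norm (f t - t ^ n *\<^sub>R r) \<le> e * \<bar>t\<bar> ^ n) (nhds 0)"
proof -
  have "eventually (\<lambda>t. dist ((1 / t ^ n) *\<^sub>R f t) r < e) (at 0)"
    using assms(1,2) by (rule tendstoD)
  then have "eventually (\<lambda>t. norm (f t - t ^ n *\<^sub>R r) \<le> e * \<bar>t\<bar> ^ n) (at 0)"
    using eventually_neq_at_within[of 0 0]
  proof eventually_elim
    case (elim t)
    then have "f t - t ^ n *\<^sub>R r = t ^ n *\<^sub>R ((1 / t ^ n) *\<^sub>R f t - r)"
      by (simp add: scaleR_diff_right)
    then have "norm (f t - t ^ n *\<^sub>R r) = \<bar>t\<bar> ^ n * dist ((1 / t ^ n) *\<^sub>R f t) r"
      by (simp add: dist_norm power_abs)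
    also have "\<dots> \<le> \<bar>t\<bar> ^ n * e"
      using elim by (intro mult_left_mono) auto
    finally show ?case
      by (simp add: mult.commute)
  qed
  then show ?thesis
    unfolding eventually_at_filter
  proof eventually_elim
    case (elim t)
    then show ?case
      using assms(3,4) by (cases "t = 0") (auto simp: power_0_left)
  qed
qed

lemma bounded_bilinear_square_add:
  assumes "bounded_bilinear B" and "\<And>x y. B x y = B y x"
  shows "B (x + y) (x + y) = B x x + 2 *\<^sub>R B x y + B y y"
proof -
  interpret B: bounded_bilinear B by fact
  show ?thesis
    by (simp add: B.add_left B.add_right assms(2)[of y x] scaleR_2)
qed

text \<open>The core estimate, freed from graphs: \<open>q \<mapsto> B q q\<close> stands for the
  squared edge lengths, \<open>2 *\<^sub>R B p\<close> for their differential at p, and V for the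
  pinned space. The last hypothesis says that no direction in V cancels the order-k error r of the
  curve. Moving along the curve then costs order k, moving across it costs order 1.\<close>

lemma bilinear_square_growth_along_kernel_line:
  fixes B :: "'a::euclidean_space \<Rightarrow> 'a \<Rightarrow> 'b::euclidean_space" and \<gamma> :: "real \<Rightarrow> 'a"
  assumes "bounded_bilinear B" and sym: "\<And>x y. B x y = B y x"
    and V: "subspace V" and dimK: "dim {x \<in> V. B p x = 0} = 1" and k: "k \<ge> 2"
    and \<gamma>0: "\<gamma> 0 = p"
    and \<gamma>_cont: "eventually (\<lambda>t. isCont \<gamma> t) (nhds 0)"
    and \<gamma>_V: "eventually (\<lambda>t. \<gamma> t - p \<in> V) (nhds 0)"
    and \<gamma>_lim: "((\<lambda>t. (1 / t) *\<^sub>R (\<gamma> t - p)) \<longlongrightarrow> u) (at 0)" and "u \<noteq> 0"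
    and r_lim: "((\<lambda>t. (1 / t ^ k) *\<^sub>R (B (\<gamma> t) (\<gamma> t) - B p p)) \<longlongrightarrow> r) (at 0)"
    and r: "\<And>w. w \<in> V \<Longrightarrow> r + 2 *\<^sub>R B p w \<noteq> 0"
  obtains c where "c > 0"
    "eventually (\<lambda>q. q - p \<in> V \<longrightarrow> c * norm (q - p) ^ k \<le> norm (B q q - B p p)) (nhds p)"
proof -
  interpret B: bounded_bilinear B by fact
  note expand = bounded_bilinear_square_add[OF assms(1) sym]
  let ?K = "{x \<in> V. B p x = 0}"
  have subK: "subspace ?K"
    using V by (auto simp: subspace_def B.add_right B.scaleR_right B.zero_right)
  have "u \<in> V"
  proof (rule Lim_in_closed_set[OF closed_subspace[OF V] _ _ \<gamma>_lim])
    show "eventually (\<lambda>t. (1 / t) *\<^sub>R (\<gamma> t - p) \<in> V) (at 0)"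
      using \<gamma>_V V unfolding eventually_at_filter by (auto elim!: eventually_mono intro: subspace_scale)
  qed simp
  have \<gamma>_p: "((\<lambda>t. \<gamma> t - p) \<longlongrightarrow> 0) (at 0)"
    using eventually_nhds_x_imp_x[OF \<gamma>_cont] \<gamma>0
    by (auto simp: isCont_def intro: tendsto_eq_intros)
  \<comment> \<open>Divide the expansion of \<open>B (\<gamma> t) (\<gamma> t) - B p p\<close> by t.
    The quadratic part keeps a factor \<open>\<gamma> t - p\<close> and disappears, leaving
    \<open>2 *\<^sub>R B p u\<close>; but the same quotient is \<open>t ^ (k - 1)\<close> times a
    convergent one, hence null because k \<ge> 2.\<close>
  have "B p u = 0"
  proof -
    have lim1: "((\<lambda>t. 2 *\<^sub>R B p ((1 / t) *\<^sub>R (\<gamma> t - p)) + B ((1 / t) *\<^sub>R (\<gamma> t - p)) (\<gamma> t - p))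
            \<longlongrightarrow> 2 *\<^sub>R B p u + B u 0) (at 0)"
      by (intro tendsto_intros B.tendsto \<gamma>_lim \<gamma>_p)
    have lim2: "((\<lambda>t. t ^ (k - 1) *\<^sub>R ((1 / t ^ k) *\<^sub>R (B (\<gamma> t) (\<gamma> t) - B p p)))
            \<longlongrightarrow> 0 ^ (k - 1) *\<^sub>R r) (at 0)"
      by (intro tendsto_intros r_lim)
    have ev: "eventually (\<lambda>t. t ^ (k - 1) *\<^sub>R ((1 / t ^ k) *\<^sub>R (B (\<gamma> t) (\<gamma> t) - B p p))
        = 2 *\<^sub>R B p ((1 / t) *\<^sub>R (\<gamma> t - p)) + B ((1 / t) *\<^sub>R (\<gamma> t - p)) (\<gamma> t - p)) (at 0)"
      unfolding eventually_at_filter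
    proof (intro always_eventually allI impI)
      fix t :: real assume "t \<noteq> 0"
      moreover have "t ^ k = t * t ^ (k - 1)"
        using k by (cases k) auto
      ultimately have pow: "t ^ (k - 1) *\<^sub>R ((1 / t ^ k) *\<^sub>R x) = (1 / t) *\<^sub>R x" for x :: 'b
        by simp
      have "B (\<gamma> t) (\<gamma> t) - B p p = 2 *\<^sub>R B p (\<gamma> t - p) + B (\<gamma> t - p) (\<gamma> t - p)"
        using expand[of p "\<gamma> t - p"] by simp
      then show "t ^ (k - 1) *\<^sub>R ((1 / t ^ k) *\<^sub>R (B (\<gamma> t) (\<gamma> t) - B p p))
        = 2 *\<^sub>R B p ((1 / t) *\<^sub>R (\<gamma> t - p)) + B ((1 / t) *\<^sub>R (\<gamma> t - p)) (\<gamma> t - p)"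
        unfolding pow by (simp add: B.scaleR_left B.scaleR_right scaleR_add_right)
    qed
    have "2 *\<^sub>R B p u + B u 0 = 0 ^ (k - 1) *\<^sub>R r"
      by (rule tendsto_unique[OF at_neq_bot lim1 Lim_transform_eventually[OF lim2 ev]])
    then show ?thesis
      using k by (simp add: B.zero_right power_0_left)
  qed
  have K_span: "?K = span {u}"
  proof (rule subspace_dim_equal[symmetric])
    show "span {u} \<subseteq> ?K"
      using \<open>u \<in> V\<close> \<open>B p u = 0\<close> subK by (intro span_minimal) auto
    show "dim ?K \<le> dim (span {u})"
      using dimK \<open>u \<noteq> 0\<close> by (simp add: dim_singleton)
  qed (use subK in auto)

  \<comment> \<open>W is the part of V transversal to the kernel line: a multiple of u that is
    orthogonal to u is 0, so \<open>B p\<close> is injective on W.\<close>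
  define W where "W = {w \<in> V. w \<bullet> u = 0}"
  have subW: "subspace W"
    using V unfolding W_def by (auto simp: subspace_def inner_add_left)
  have W_inj: "w = 0" if "w \<in> W" "B p w = 0" for w
  proof -
    have "w \<in> span {u}"
      using that K_span by (auto simp: W_def)
    then obtain s where "w = s *\<^sub>R u"
      by (auto simp: span_singleton)
    then show ?thesis
      using that \<open>u \<noteq> 0\<close> by (simp add: W_def)
  qed

  \<comment> \<open>The linear model of \<open>B q q - B p p\<close> at
    \<open>q = \<gamma> t + w\<close>, with s standing for \<open>t ^ k\<close>. In finite
    dimension, injectivity on a closed subspace already gives a lower bound by a multiple of the
    norm.\<close>
  define L where "L = (\<lambda>z::real \<times> 'a. fst z *\<^sub>R r + 2 *\<^sub>R B p (snd z))"
  have "\<exists>c>0. \<forall>z\<in>UNIV \<times> W. norm (L z) \<ge> c * norm z"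
  proof (rule injective_imp_isometric)
    show sub: "subspace ((UNIV :: real set) \<times> W)"
      by (intro subspace_Times subW) auto
    then show "closed ((UNIV :: real set) \<times> W)"
      by (rule closed_subspace)
    have "bounded_linear (\<lambda>z. 2 *\<^sub>R B p (snd z))"
      by (intro bounded_linear_compose[OF bounded_linear_scaleR_right]
          bounded_linear_compose[OF B.bounded_linear_right bounded_linear_snd])
    then show "bounded_linear L"
      unfolding L_def
      by (intro bounded_linear_add bounded_linear_compose[OF bounded_linear_scaleR_left bounded_linear_fst])
    show "\<forall>z\<in>UNIV \<times> W. L z = 0 \<longrightarrow> z = 0"
    proof (safe, goal_cases)
      case (1 s w)
      \<comment> \<open>If s were nonzero, dividing by s would make w / s a direction that cancels
        r. With s = 0 only \<open>B p w = 0\<close> remains, and \<open>W_inj\<close>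
        applies.\<close>
      have "s = 0"
      proof (rule ccontr)
        assume "s \<noteq> 0"
        have "r + 2 *\<^sub>R B p ((1 / s) *\<^sub>R w) = (1 / s) *\<^sub>R L (s, w)"
          using \<open>s \<noteq> 0\<close> by (simp add: L_def B.scaleR_right scaleR_add_right)
        then have "r + 2 *\<^sub>R B p ((1 / s) *\<^sub>R w) = 0"
          using 1 by simp
        moreover have "(1 / s) *\<^sub>R w \<in> V"
          using 1 V by (auto simp: W_def intro: subspace_scale)
        ultimately show False
          using r by blast
      qed
      then show ?case
        using 1 W_inj[of w] by (auto simp: L_def zero_prod_def)
    qed
  qed
  then obtain c where c: "c > 0" "\<And>s w. w \<in> W \<Longrightarrow> c * norm (s, w) \<le> norm (L (s, w))"
    by auto
  obtain N where N: "N > 0" "\<And>x y. norm (B x y) \<le> norm x * norm y * N"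
    using B.pos_bounded by blast

  define a where "a = norm u"
  define b where "b = a + 1"
  have a: "a > 0" and b: "b > 1" using \<open>u \<noteq> 0\<close> by (auto simp: a_def b_def)
  \<comment> \<open>The tangent remainder is bounded twice: by \<open>\<bar>t\<bar>\<close>, which
    gives \<open>norm (\<gamma> t - p) \<le> b * \<bar>t\<bar>\<close>, and by
    \<open>a / 2 * \<bar>t\<bar>\<close>, which keeps the component along u within half of its
    linear term.\<close>
  have \<gamma>_lim': "((\<lambda>t. (1 / t ^ 1) *\<^sub>R (\<gamma> t - p)) \<longlongrightarrow> u) (at 0)"
    using \<gamma>_lim by simp
  have ev1: "eventually (\<lambda>t. norm (\<gamma> t - p - t ^ 1 *\<^sub>R u) \<le> 1 * \<bar>t\<bar> ^ 1) (nhds 0)"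
    by (intro eventually_norm_remainder_le \<gamma>_lim') (auto simp: \<gamma>0)
  have ev2: "eventually (\<lambda>t. norm (\<gamma> t - p - t ^ 1 *\<^sub>R u) \<le> (a / 2) * \<bar>t\<bar> ^ 1) (nhds 0)"
    using a by (intro eventually_norm_remainder_le \<gamma>_lim') (auto simp: \<gamma>0)
  have ev3: "eventually (\<lambda>t. norm (B (\<gamma> t) (\<gamma> t) - B p p - t ^ k *\<^sub>R r) \<le> (c / 8) * \<bar>t\<bar> ^ k) (nhds 0)"
    using c k by (intro eventually_norm_remainder_le r_lim) (auto simp: \<gamma>0)
  have "eventually (\<lambda>t. isCont \<gamma> t \<and> \<gamma> t - p \<in> V \<and> norm (\<gamma> t - p - t *\<^sub>R u) \<le> \<bar>t\<bar>
      \<and> norm (\<gamma> t - p - t *\<^sub>R u) \<le> (a / 2) * \<bar>t\<bar>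
      \<and> norm (B (\<gamma> t) (\<gamma> t) - B p p - t ^ k *\<^sub>R r) \<le> (c / 8) * \<bar>t\<bar> ^ k) (nhds 0)"
    using \<gamma>_cont \<gamma>_V ev1 ev2 ev3 by eventually_elim auto
  then obtain \<delta>' where \<delta>': "\<delta>' > 0" "\<And>t. \<bar>t\<bar> < \<delta>' \<Longrightarrow> isCont \<gamma> t \<and> \<gamma> t - p \<in> V
      \<and> norm (\<gamma> t - p - t *\<^sub>R u) \<le> \<bar>t\<bar>
      \<and> norm (\<gamma> t - p - t *\<^sub>R u) \<le> (a / 2) * \<bar>t\<bar>
      \<and> norm (B (\<gamma> t) (\<gamma> t) - B p p - t ^ k *\<^sub>R r) \<le> (c / 8) * \<bar>t\<bar> ^ k"
    unfolding eventually_nhds_metric dist_real_def by auto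
  \<comment> \<open>The half puts the closed interval inside the open one; the second bound makes
    the cross term \<open>2 *\<^sub>R B (\<gamma> t - p) w\<close> at most
    \<open>c / 8 * norm w\<close>.\<close>
  define \<delta> where "\<delta> = min (\<delta>' / 2) (c / (16 * N * b))"
  have \<delta>: "\<delta> > 0" "\<delta> < \<delta>'" "\<delta> \<le> c / (16 * N * b)"
    using \<delta>' c N b by (auto simp: \<delta>_def)
  have cont: "isCont \<gamma> t" and inV: "\<gamma> t - p \<in> V"
    and small: "norm (\<gamma> t - p - t *\<^sub>R u) \<le> \<bar>t\<bar>" "norm (\<gamma> t - p - t *\<^sub>R u) \<le> (a / 2) * \<bar>t\<bar>"
    and rem: "norm (B (\<gamma> t) (\<gamma> t) - B p p - t ^ k *\<^sub>R r) \<le> (c / 8) * \<bar>t\<bar> ^ k"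
    if "\<bar>t\<bar> \<le> \<delta>" for t
    using \<delta>'(2)[of t] \<delta> that by auto
  define \<phi> where "\<phi> = (\<lambda>t. (\<gamma> t - p) \<bullet> u)"
  have \<phi>: "\<bar>\<phi> t - a\<^sup>2 * t\<bar> \<le> a\<^sup>2 / 2 * \<bar>t\<bar>" if "\<bar>t\<bar> \<le> \<delta>" for t
  proof -
    have "\<phi> t - a\<^sup>2 * t = (\<gamma> t - p - t *\<^sub>R u) \<bullet> u"
      by (simp add: \<phi>_def a_def inner_diff_left power2_norm_eq_inner)
    also have "\<bar>\<dots>\<bar> \<le> norm (\<gamma> t - p - t *\<^sub>R u) * norm u"
      by (rule Cauchy_Schwarz_ineq2)
    also have "\<dots> \<le> (a / 2) * \<bar>t\<bar> * a"
      unfolding a_def[symmetric] using small(2)[OF that] a by (intro mult_right_mono) auto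
    finally show ?thesis by (simp add: power2_eq_square algebra_simps)
  qed

  \<comment> \<open>The first bound keeps \<open>(q - p) \<bullet> u\<close> in the range that
    \<open>\<phi>\<close> is sure to cover on the interval from \<open>- \<delta>\<close> to
    \<open>\<delta>\<close>. The second forces \<open>norm w\<close> below both
    \<open>c / (8 * N)\<close> and 1, since \<open>norm w\<close> will be at most
    \<open>1 + 2 * b / a\<close> times \<open>norm (q - p)\<close>.\<close>
  define \<rho> where "\<rho> = min (a * \<delta> / 2) (min (c / (8 * N)) 1 / (1 + 2 * b / a))"
  have fac: "1 + 2 * b / a > 0" using a b by (simp add: add_pos_pos)
  have \<rho>: "\<rho> > 0" "\<rho> \<le> a * \<delta> / 2" "(1 + 2 * b / a) * \<rho> \<le> c / (8 * N)" "(1 + 2 * b / a) * \<rho> \<le> 1"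
  proof -
    show "\<rho> > 0" "\<rho> \<le> a * \<delta> / 2"
      using a b c N \<delta> fac by (auto simp: \<rho>_def)
    have "(1 + 2 * b / a) * \<rho> \<le> (1 + 2 * b / a) * (min (c / (8 * N)) 1 / (1 + 2 * b / a))"
      using fac by (intro mult_left_mono) (auto simp: \<rho>_def)
    also have "\<dots> = min (c / (8 * N)) 1"
      using fac by simp
    finally show "(1 + 2 * b / a) * \<rho> \<le> c / (8 * N)" "(1 + 2 * b / a) * \<rho> \<le> 1"
      by auto
  qed

  \<comment> \<open>The factor \<open>c / 4\<close> is what survives of c after absorbing the error
    terms; \<open>(2 * b) ^ k\<close> is the cost of bounding \<open>norm (q - p) ^ k\<close> by
    \<open>\<bar>t\<bar> ^ k + norm w\<close>.\<close>
  define c' where "c' = c / 4 / (2 * b) ^ k"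
  have "c' * norm (q - p) ^ k \<le> norm (B q q - B p p)" if qV: "q - p \<in> V" and q: "norm (q - p) < \<rho>" for q
  proof -
    have "\<bar>(q - p) \<bullet> u\<bar> \<le> norm (q - p) * a"
      unfolding a_def by (rule Cauchy_Schwarz_ineq2)
    also have "\<dots> \<le> (a * \<delta> / 2) * a"
      using q \<rho> a by (intro mult_right_mono) auto
    finally have y: "\<bar>(q - p) \<bullet> u\<bar> \<le> a\<^sup>2 / 2 * \<delta>"
      by (simp add: power2_eq_square algebra_simps)
    \<comment> \<open>Choosing t so that the curve and q have the same component along u makes
      \<open>q - \<gamma> t\<close> orthogonal to u, hence an element of W.\<close>
    have "\<exists>t. - \<delta> \<le> t \<and> t \<le> \<delta> \<and> \<phi> t = (q - p) \<bullet> u"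
    proof (rule IVT)
      show "\<phi> (- \<delta>) \<le> (q - p) \<bullet> u" "(q - p) \<bullet> u \<le> \<phi> \<delta>"
        using \<phi>[of \<delta>] \<phi>[of "- \<delta>"] y \<delta>(1) by (simp; linarith)+
      show "\<forall>t. - \<delta> \<le> t \<and> t \<le> \<delta> \<longrightarrow> isCont \<phi> t"
        unfolding \<phi>_def using cont by (auto intro!: continuous_intros)
    qed (use \<delta> in auto)
    then obtain t where t: "\<bar>t\<bar> \<le> \<delta>" "\<phi> t = (q - p) \<bullet> u"
      by (metis abs_le_iff minus_le_iff)
    define w where "w = q - \<gamma> t"
    have "w \<in> V"
      using subspace_diff[OF V qV inV[OF t(1)]] by (simp add: w_def)
    then have wW: "w \<in> W"
      using t(2) by (simp add: W_def w_def \<phi>_def inner_diff_left)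
    have \<gamma>t: "norm (\<gamma> t - p) \<le> b * \<bar>t\<bar>"
    proof -
      have "norm (\<gamma> t - p) \<le> norm (\<gamma> t - p - t *\<^sub>R u) + norm (t *\<^sub>R u)"
        using norm_triangle_ineq[of "\<gamma> t - p - t *\<^sub>R u" "t *\<^sub>R u"] by simp
      then show ?thesis
        using small(1)[OF t(1)] by (simp add: a_def b_def algebra_simps)
    qed
    have tq: "\<bar>t\<bar> \<le> 2 / a * norm (q - p)"
    proof -
      have "a\<^sup>2 * \<bar>t\<bar> = \<bar>a\<^sup>2 * t\<bar>" by (simp add: abs_mult)
      also have "\<dots> \<le> \<bar>\<phi> t\<bar> + a\<^sup>2 / 2 * \<bar>t\<bar>"
        using \<phi>[OF t(1)] by linarith
      also have "\<bar>\<phi> t\<bar> \<le> norm (q - p) * a"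
        unfolding t(2) a_def by (rule Cauchy_Schwarz_ineq2)
      finally have "a * (a * \<bar>t\<bar>) \<le> a * (2 * norm (q - p))"
        by (simp add: power2_eq_square algebra_simps)
      then show ?thesis
        using a by (simp add: field_simps)
    qed
    have "norm w \<le> norm (q - p) + norm (\<gamma> t - p)"
      using norm_triangle_ineq4[of "q - p" "\<gamma> t - p"] by (simp add: w_def)
    also have "\<dots> \<le> norm (q - p) + b * (2 / a * norm (q - p))"
      using \<gamma>t mult_left_mono[OF tq, of b] b by simp
    also have "\<dots> = (1 + 2 * b / a) * norm (q - p)"
      by (simp add: algebra_simps)
    also have "\<dots> \<le> (1 + 2 * b / a) * \<rho>"
      using q fac by (intro mult_left_mono) auto
    finally have w: "norm w \<le> c / (8 * N)" "norm w \<le> 1"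
      using \<rho> by auto

    \<comment> \<open>Expand \<open>B q q\<close> around \<open>\<gamma> t\<close> and replace
      \<open>B (\<gamma> t) w\<close> by \<open>B p w\<close>. Three errors arise: the curve's
      remainder beyond \<open>t ^ k *\<^sub>R r\<close>, the cross term, and the square of
      w.\<close>
    have "L (t ^ k, w) = (B q q - B p p) - (B (\<gamma> t) (\<gamma> t) - B p p - t ^ k *\<^sub>R r)
        - 2 *\<^sub>R B (\<gamma> t - p) w - B w w"
    proof -
      have "B q q = B (\<gamma> t) (\<gamma> t) + 2 *\<^sub>R B (\<gamma> t) w + B w w"
        using expand[of "\<gamma> t" w] by (simp add: w_def)
      then show ?thesis
        by (simp add: L_def B.diff_left scaleR_diff_right)
    qed
    moreover have "norm (x - y - z - v) \<le> norm x + norm y + norm z + norm v" for x y z v :: 'b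
      using norm_triangle_ineq4[of x y] norm_triangle_ineq4[of "x - y" z]
        norm_triangle_ineq4[of "x - y - z" v] by linarith
    ultimately have "norm (L (t ^ k, w)) \<le> norm (B q q - B p p)
        + norm (B (\<gamma> t) (\<gamma> t) - B p p - t ^ k *\<^sub>R r) + norm (2 *\<^sub>R B (\<gamma> t - p) w) + norm (B w w)"
      by metis
    moreover have "norm (2 *\<^sub>R B (\<gamma> t - p) w) \<le> c / 8 * norm w"
    proof -
      have "norm (B (\<gamma> t - p) w) \<le> norm (\<gamma> t - p) * norm w * N"
        by (rule N)
      also have "\<dots> \<le> (b * (c / (16 * N * b))) * norm w * N"
      proof (intro mult_right_mono)
        have "b * \<bar>t\<bar> \<le> b * (c / (16 * N * b))"
          using t(1) \<delta>(3) b by (intro mult_left_mono) auto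
        then show "norm (\<gamma> t - p) \<le> b * (c / (16 * N * b))"
          using \<gamma>t by linarith
      qed (use N in auto)
      also have "\<dots> = c / 16 * norm w"
        using N b by simp
      finally show ?thesis by simp
    qed
    moreover have "norm (B w w) \<le> c / 8 * norm w"
    proof -
      have "norm (B w w) \<le> norm w * norm w * N"
        by (rule N)
      also have "\<dots> \<le> (c / (8 * N)) * norm w * N"
        using w N by (intro mult_right_mono) auto
      finally show ?thesis using N by simp
    qed
    moreover have "c / 2 * (\<bar>t\<bar> ^ k + norm w) \<le> norm (L (t ^ k, w))"
    proof -
      have "\<bar>t\<bar> ^ k + norm w \<le> 2 * norm (t ^ k, w)"
        using norm_fst_le[of "t ^ k" w] norm_snd_le[of w "t ^ k"] by (simp add: power_abs)
      then have "c / 2 * (\<bar>t\<bar> ^ k + norm w) \<le> c / 2 * (2 * norm (t ^ k, w))"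
        using c(1) by (intro mult_left_mono) auto
      then show ?thesis
        using c(2)[OF wW, of "t ^ k"] by simp
    qed
    moreover have "0 \<le> c * \<bar>t\<bar> ^ k"
      using c(1) by simp
    \<comment> \<open>Of the lower bound \<open>c / 2\<close> the errors use up \<open>c / 8\<close>
      in front of \<open>\<bar>t\<bar> ^ k\<close> and twice \<open>c / 8\<close> in front of
      \<open>norm w\<close>, so at least \<open>c / 4\<close> remains for both.\<close>
    ultimately have main: "c / 4 * (\<bar>t\<bar> ^ k + norm w) \<le> norm (B q q - B p p)"
      using rem[OF t(1)] unfolding distrib_left by linarith

    have "norm (q - p) \<le> b * \<bar>t\<bar> + norm w"
      using \<gamma>t norm_triangle_ineq[of "\<gamma> t - p" w] by (simp add: w_def)
    then have "norm (q - p) ^ k \<le> (b * \<bar>t\<bar> + norm w) ^ k"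
      by (intro power_mono) auto
    also have "\<dots> \<le> 2 ^ k * ((b * \<bar>t\<bar>) ^ k + norm w ^ k)"
      using b by (intro power_add_le_two_power_mult) auto
    also have "\<dots> \<le> 2 ^ k * (b ^ k * \<bar>t\<bar> ^ k + b ^ k * norm w)"
    proof -
      \<comment> \<open>Here \<open>norm w \<le> 1\<close> lets the linear cost of w dominate its
        k-th power.\<close>
      have "norm w ^ k \<le> norm w ^ 1"
        using w k by (intro power_decreasing) auto
      also have "\<dots> \<le> b ^ k * norm w"
        using b by (simp add: mult_le_cancel_right1 one_le_power)
      finally show ?thesis
        by (simp add: power_mult_distrib)
    qed
    also have "\<dots> = (2 * b) ^ k * (\<bar>t\<bar> ^ k + norm w)"
      by (simp add: power_mult_distrib algebra_simps)
    finally have "c' * norm (q - p) ^ k \<le> c' * ((2 * b) ^ k * (\<bar>t\<bar> ^ k + norm w))"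
      using c b by (intro mult_left_mono) (auto simp: c'_def)
    also have "\<dots> = c / 4 * (\<bar>t\<bar> ^ k + norm w)"
      using b by (simp add: c'_def)
    finally show ?thesis using main by linarith
  qed
  then have "eventually (\<lambda>q. q - p \<in> V \<longrightarrow> c' * norm (q - p) ^ k \<le> norm (B q q - B p p)) (nhds p)"
    unfolding eventually_nhds_metric using \<rho>(1) by (auto simp: dist_norm)
  moreover have "c' > 0"
    using c b by (simp add: c'_def)
  ultimately show thesis by (rule that[rotated])
qed

section \<open>Stiff-bar energies\<close>

text \<open>\<open>edge_form E q q\<close> is the paper's \<open>m(q)\<close>, padded with zeros outside \<open>E\<close>; its
  derivative at \<open>p\<close> is \<open>2 (edge_form E p)\<close>, whose kernel is \<open>K\<close>.\<close>
definition edge_form :: "('v \<times> 'v) set \<Rightarrow> real^'d^'v \<Rightarrow> real^'d^'v \<Rightarrow> real^('v::finite \<times> 'v)" where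
  "edge_form E x y = (\<chi> e. if e \<in> E then (x $ fst e - x $ snd e) \<bullet> (y $ fst e - y $ snd e) else 0)"

lemma bounded_bilinear_edge_form: "bounded_bilinear (edge_form E)"
  unfolding bilinear_conv_bounded_bilinear[symmetric] bilinear_def
  by (intro conjI allI linearI)
     (auto simp: edge_form_def vec_eq_iff inner_diff_left inner_diff_right inner_add_left
        inner_add_right algebra_simps)

lemma edge_form_commute: "edge_form E x y = edge_form E y x"
  by (simp add: edge_form_def vec_eq_iff inner_commute)

lemma edge_form_self_nth:
  "(v, w) \<in> E \<Longrightarrow> edge_form E q q $ (v, w) = (norm (q $ v - q $ w))\<^sup>2"
  by (simp add: edge_form_def power2_norm_eq_inner)

lemma subspace_pinned_space: "subspace (pinned_space l)"
  by (auto simp: subspace_def pinned_space_def)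

lemma Kspace_eq_edge_form_kernel: "Kspace l E p = {x \<in> pinned_space l. edge_form E p x = 0}"
  by (auto simp: Kspace_def edge_form_def vec_eq_iff)

lemma norm_edge_form_diff_power2:
  "(norm (edge_form E q q - edge_form E p p))\<^sup>2
    = (\<Sum>(v, w)\<in>E. ((dist (q $ v) (q $ w))\<^sup>2 - (dist (p $ v) (p $ w))\<^sup>2)\<^sup>2)"
proof -
  have "(norm (edge_form E q q - edge_form E p p))\<^sup>2
    = (\<Sum>e\<in>UNIV. ((edge_form E q q - edge_form E p p) $ e)\<^sup>2)"
    unfolding power2_norm_eq_inner by (simp add: inner_vec_def power2_eq_square)
  also have "\<dots> = (\<Sum>e\<in>E. ((edge_form E q q - edge_form E p p) $ e)\<^sup>2)"
    by (intro sum.mono_neutral_right) (auto simp: edge_form_def)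
  also have "\<dots> = (\<Sum>(v, w)\<in>E. ((dist (q $ v) (q $ w))\<^sup>2 - (dist (p $ v) (p $ w))\<^sup>2)\<^sup>2)"
    by (intro sum.cong) (auto simp: edge_form_self_nth dist_norm)
  finally show ?thesis .
qed

section \<open>One-variable bar energies near their minimum\<close>

lemma deriv_shift:
  fixes f :: "'a::real_normed_field \<Rightarrow> 'a"
  shows "deriv (\<lambda>t. f (d + t)) x = deriv f (d + x)"
proof -
  have "((\<lambda>t. f (d + t)) has_field_derivative D) (at x) \<longleftrightarrow> (f has_field_derivative D) (at (d + x))" for D
    using DERIV_shift[of f D x d] by (simp add: add.commute)
  then show ?thesis by (simp add: deriv_def)
qed

text \<open>The linear Taylor coefficient vanishes at a local minimum, and the quadratic one, a, is
  half the second derivative and so positive. The quotient of \<open>f x - f d\<close> by the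
  squared displacement tends to a, hence stays between \<open>a / 2\<close> and
  \<open>2 * a\<close>.\<close>

lemma real_analytic_strict_min_quadratic:
  assumes "real_analytic_at f d" and "(deriv ^^ 2) f d > 0"
    and min: "\<delta> > 0" "\<And>x. x \<noteq> d \<Longrightarrow> \<bar>x - d\<bar> < \<delta> \<Longrightarrow> f d < f x"
  obtains c C where "c > 0" "C > 0"
    "eventually (\<lambda>x. c * (x - d)\<^sup>2 \<le> f x - f d \<and> f x - f d \<le> C * (x - d)\<^sup>2) (nhds d)"
proof -
  let ?g = "\<lambda>t. f (d + t)"
  obtain F where F: "?g has_fps_expansion F"
    using assms(1) real_analytic_at_iff_has_fps_expansion by blast
  have F0: "fps_nth F 0 = f d"
    using has_fps_expansion_at_0[OF F] by simp
  let ?G = "F - fps_const (f d)"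
  have G: "(\<lambda>t. ?g t - f d) has_fps_expansion ?G"
    by (intro has_fps_expansion_diff F has_fps_expansion_const)
  have "((\<lambda>t. (?g t - f d) / t ^ 1) \<longlongrightarrow> fps_nth ?G 1) (at 0)"
    by (intro has_fps_expansion_tendsto_divide_power G) (simp add: F0)
  then have "DERIV f d :> fps_nth ?G 1"
    by (simp add: DERIV_def)
  then have G1: "fps_nth ?G 1 = 0"
    by (rule DERIV_local_min[OF _ min(1)]) (metis min(2) abs_minus_commute order.order_iff_strict)
  define a where "a = fps_nth ?G 2"
  have "(deriv ^^ 2) f d = (deriv ^^ 2) ?g 0"
  proof -
    have "deriv ?g = (\<lambda>t. deriv f (d + t))"
      by (rule ext) (rule deriv_shift)
    then show ?thesis
      using deriv_shift[of "deriv f" d 0] by (simp add: eval_nat_numeral)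
  qed
  also have "\<dots> = 2 * a"
    by (simp add: higher_deriv_has_fps_expansion[OF F] a_def)
  finally have a: "a > 0" using assms(2) by simp
  have lim: "((\<lambda>t. (?g t - f d) / t ^ 2) \<longlongrightarrow> a) (at 0)"
    unfolding a_def
  proof (intro has_fps_expansion_tendsto_divide_power G)
    show "fps_nth ?G i = 0" if "i < 2" for i
      using that G1 F0 by (auto simp: less_2_cases_iff)
  qed
  have "eventually (\<lambda>t. (?g t - f d) / t ^ 2 > a / 2) (at 0)"
    using a by (intro order_tendstoD(1)[OF lim]) simp
  moreover have "eventually (\<lambda>t. (?g t - f d) / t ^ 2 < 2 * a) (at 0)"
    using a by (intro order_tendstoD(2)[OF lim]) simp
  ultimately have "eventually (\<lambda>t. a / 2 * t\<^sup>2 \<le> ?g t - f d \<and> ?g t - f d \<le> 2 * a * t\<^sup>2) (nhds 0)"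
    unfolding eventually_at_filter
  proof eventually_elim
    case (elim t)
    then show ?case
      by (cases "t = 0") (auto simp: field_simps)
  qed
  then obtain e where "e > 0" and
    e: "\<And>t. \<bar>t\<bar> < e \<Longrightarrow> a / 2 * t\<^sup>2 \<le> ?g t - f d \<and> ?g t - f d \<le> 2 * a * t\<^sup>2"
    unfolding eventually_nhds_metric dist_real_def by auto
  have "a / 2 * (x - d)\<^sup>2 \<le> f x - f d \<and> f x - f d \<le> 2 * a * (x - d)\<^sup>2" if "dist x d < e" for x
    using e[of "x - d"] that by (simp add: dist_real_def)
  then have "eventually (\<lambda>x. a / 2 * (x - d)\<^sup>2 \<le> f x - f d \<and> f x - f d \<le> 2 * a * (x - d)\<^sup>2) (nhds d)"
    unfolding eventually_nhds_metric using \<open>e > 0\<close> by blast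
  then show thesis
    using a by (intro that[of "a / 2" "2 * a"]) auto
qed

text \<open>Squared lengths are as good as lengths away from 0: the two squared differences differ
  by the factor \<open>(x + d)\<^sup>2\<close>, which for 0 < x < 2d lies between
  \<open>d\<^sup>2\<close> and \<open>9 * d\<^sup>2\<close>.\<close>

lemma real_analytic_strict_min_quadratic_in_squares:
  assumes "real_analytic_at f d" and "(deriv ^^ 2) f d > 0" and "d > 0"
    and min: "\<delta> > 0" "\<And>x. x \<noteq> d \<Longrightarrow> \<bar>x - d\<bar> < \<delta> \<Longrightarrow> f d < f x"
  obtains c C where "c > 0" "C > 0"
    "eventually (\<lambda>x. c * (x\<^sup>2 - d\<^sup>2)\<^sup>2 \<le> f x - f d \<and> f x - f d \<le> C * (x\<^sup>2 - d\<^sup>2)\<^sup>2) (nhds d)"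
proof -
  obtain c C where cC: "c > 0" "C > 0"
    "eventually (\<lambda>x. c * (x - d)\<^sup>2 \<le> f x - f d \<and> f x - f d \<le> C * (x - d)\<^sup>2) (nhds d)"
    using real_analytic_strict_min_quadratic[OF assms(1,2) min] by blast
  have "eventually (\<lambda>x. x \<in> {0<..<2 * d}) (nhds d)"
    using \<open>d > 0\<close> by (intro eventually_nhds_in_open) auto
  with cC(3) have "eventually (\<lambda>x. c / (9 * d\<^sup>2) * (x\<^sup>2 - d\<^sup>2)\<^sup>2 \<le> f x - f d
      \<and> f x - f d \<le> C / d\<^sup>2 * (x\<^sup>2 - d\<^sup>2)\<^sup>2) (nhds d)"
  proof eventually_elim
    case (elim x)
    have sq: "(x\<^sup>2 - d\<^sup>2)\<^sup>2 = (x - d)\<^sup>2 * (x + d)\<^sup>2"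
      by (simp add: power2_eq_square algebra_simps)
    have "(x + d)\<^sup>2 \<le> (3 * d)\<^sup>2" "d\<^sup>2 \<le> (x + d)\<^sup>2"
      using elim \<open>d > 0\<close> by (intro power_mono; simp)+
    then have "(x - d)\<^sup>2 * (x + d)\<^sup>2 \<le> (x - d)\<^sup>2 * (9 * d\<^sup>2)"
      and "(x - d)\<^sup>2 * d\<^sup>2 \<le> (x - d)\<^sup>2 * (x + d)\<^sup>2"
      by (auto intro!: mult_left_mono simp: power_mult_distrib)
    then have "(x\<^sup>2 - d\<^sup>2)\<^sup>2 / (9 * d\<^sup>2) \<le> (x - d)\<^sup>2" "(x - d)\<^sup>2 \<le> (x\<^sup>2 - d\<^sup>2)\<^sup>2 / d\<^sup>2"
      using \<open>d > 0\<close> unfolding sq by (auto simp: pos_divide_le_eq pos_le_divide_eq)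
    then have "c * ((x\<^sup>2 - d\<^sup>2)\<^sup>2 / (9 * d\<^sup>2)) \<le> c * (x - d)\<^sup>2"
      "C * (x - d)\<^sup>2 \<le> C * ((x\<^sup>2 - d\<^sup>2)\<^sup>2 / d\<^sup>2)"
      using cC by (intro mult_left_mono; simp)+
    then show ?case using elim by auto
  qed
  then show thesis
    using cC \<open>d > 0\<close> by (intro that[of "c / (9 * d\<^sup>2)" "C / d\<^sup>2"]) auto
qed

text \<open>Pull the one-bar estimate back along the continuous edge-length functions, take the
  worst constants over the finitely many edges, and sum. This reduces every stiff-bar energy to one
  quantity that depends only on the framework.\<close>

lemma stiff_bar_energy_comparable:
  fixes p :: "real^'d::{finite,linorder}^'v::{finite,linorder}"
  assumes "framework E p" "stiff_bar E p F"
  obtains c C where "c > 0" "C > 0"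
    "eventually (\<lambda>q. c * (norm (edge_form E q q - edge_form E p p))\<^sup>2 \<le> energy E F q - energy E F p
       \<and> energy E F q - energy E F p \<le> C * (norm (edge_form E q q - edge_form E p p))\<^sup>2) (nhds p)"
proof -
  define D where "D = (\<lambda>(q::real^'d::{finite,linorder}^'v::{finite,linorder}) e. dist (q $ fst e) (q $ snd e))"
  define comparable where "comparable = (\<lambda>e c C. c > 0 \<and> C > 0 \<and>
      eventually (\<lambda>q. c * ((D q e)\<^sup>2 - (D p e)\<^sup>2)\<^sup>2 \<le> F e (D q e) - F e (D p e)
        \<and> F e (D q e) - F e (D p e) \<le> C * ((D q e)\<^sup>2 - (D p e)\<^sup>2)\<^sup>2) (nhds p))"
  have "\<exists>c C. comparable e c C" if "e \<in> E" for e
  proof -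
    have an: "real_analytic_at (F e) (D p e)" "(deriv ^^ 2) (F e) (D p e) > 0"
      and "\<exists>\<delta>>0. \<forall>x. x \<noteq> D p e \<and> \<bar>x - D p e\<bar> < \<delta> \<longrightarrow> F e (D p e) < F e x"
      using assms(2) that unfolding stiff_bar_def D_def by (auto simp: Let_def case_prod_beta)
    then obtain \<delta> where \<delta>: "\<delta> > 0" "\<And>x. x \<noteq> D p e \<Longrightarrow> \<bar>x - D p e\<bar> < \<delta> \<Longrightarrow> F e (D p e) < F e x"
      by blast
    have "D p e > 0"
      using assms(1) that unfolding framework_def D_def by (auto simp: case_prod_beta)
    from real_analytic_strict_min_quadratic_in_squares[OF an this \<delta>]
    obtain c C where cC: "c > 0" "C > 0"
      "eventually (\<lambda>x. c * (x\<^sup>2 - (D p e)\<^sup>2)\<^sup>2 \<le> F e x - F e (D p e)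
        \<and> F e x - F e (D p e) \<le> C * (x\<^sup>2 - (D p e)\<^sup>2)\<^sup>2) (nhds (D p e))"
      by blast
    have "isCont (\<lambda>q. D q e) p"
      unfolding D_def by (intro continuous_intros)
    then have "filterlim (\<lambda>q. D q e) (nhds (D p e)) (nhds p)"
      using tendsto_at_iff_tendsto_nhds[of "\<lambda>q. D q e" p] by (simp add: isCont_def)
    show ?thesis
      unfolding comparable_def
      by (intro exI[of _ c] exI[of _ C] conjI cC(1,2) eventually_compose_filterlim[OF cC(3) \<open>filterlim _ _ _\<close>])
  qed
  then obtain c C where "\<And>e. e \<in> E \<Longrightarrow> comparable e (c e) (C e)"
    by metis
  then have cC: "\<And>e. e \<in> E \<Longrightarrow> c e > 0" "\<And>e. e \<in> E \<Longrightarrow> C e > 0"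
    "\<And>e. e \<in> E \<Longrightarrow> eventually (\<lambda>q. c e * ((D q e)\<^sup>2 - (D p e)\<^sup>2)\<^sup>2 \<le> F e (D q e) - F e (D p e)
      \<and> F e (D q e) - F e (D p e) \<le> C e * ((D q e)\<^sup>2 - (D p e)\<^sup>2)\<^sup>2) (nhds p)"
    unfolding comparable_def by simp_all
  have fin: "finite E" by simp
  \<comment> \<open>The inserted 1 keeps the minimum and maximum defined for an empty edge set and
    makes the maximum positive.\<close>
  define c0 where "c0 = Min (insert 1 (c ` E))"
  define C0 where "C0 = Max (insert 1 (C ` E))"
  have c0: "c0 > 0" "\<And>e. e \<in> E \<Longrightarrow> c0 \<le> c e"
    unfolding c0_def using cC fin by auto
  have "1 \<le> C0"
    unfolding C0_def by (intro Max_ge) auto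
  then have C0: "C0 > 0" "\<And>e. e \<in> E \<Longrightarrow> C e \<le> C0"
    by linarith (auto simp: C0_def)
  have en: "energy E F q - energy E F p = (\<Sum>e\<in>E. F e (D q e) - F e (D p e))" for q
    by (simp add: energy_def D_def sum_subtractf case_prod_beta)
  have nrm: "(norm (edge_form E q q - edge_form E p p))\<^sup>2 = (\<Sum>e\<in>E. ((D q e)\<^sup>2 - (D p e)\<^sup>2)\<^sup>2)" for q
    by (simp add: norm_edge_form_diff_power2 D_def case_prod_beta)
  have "eventually (\<lambda>q. \<forall>e\<in>E. c e * ((D q e)\<^sup>2 - (D p e)\<^sup>2)\<^sup>2 \<le> F e (D q e) - F e (D p e)
      \<and> F e (D q e) - F e (D p e) \<le> C e * ((D q e)\<^sup>2 - (D p e)\<^sup>2)\<^sup>2) (nhds p)"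
    by (intro eventually_ball_finite fin ballI cC(3))
  then have "eventually (\<lambda>q. c0 * (norm (edge_form E q q - edge_form E p p))\<^sup>2 \<le> energy E F q - energy E F p
       \<and> energy E F q - energy E F p \<le> C0 * (norm (edge_form E q q - edge_form E p p))\<^sup>2) (nhds p)"
  proof eventually_elim
    case (elim q)
    have "c0 * ((D q e)\<^sup>2 - (D p e)\<^sup>2)\<^sup>2 \<le> F e (D q e) - F e (D p e)" if "e \<in> E" for e
      by (rule order_trans[OF mult_right_mono[OF c0(2)[OF that]]]) (use elim that in auto)
    moreover have "F e (D q e) - F e (D p e) \<le> C0 * ((D q e)\<^sup>2 - (D p e)\<^sup>2)\<^sup>2" if "e \<in> E" for e
      by (rule order_trans[OF _ mult_right_mono[OF C0(2)[OF that]]]) (use elim that in auto)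
    ultimately show ?case
      unfolding en nrm sum_distrib_left by (intro conjI sum_mono)
  qed
  with c0(1) C0(1) show thesis by (rule that)
qed

section \<open>Flexes\<close>

lemma real_analytic_at_norm_diff_power2:
  fixes P :: "real \<Rightarrow> real^'d^'v"
  assumes "\<And>v c. real_analytic_at (\<lambda>s. P s $ v $ c) t"
  shows "real_analytic_at (\<lambda>s. (norm (P s $ v - P s $ w))\<^sup>2) t"
proof -
  have "(\<lambda>s. (norm (P s $ v - P s $ w))\<^sup>2) = (\<lambda>s. \<Sum>c\<in>UNIV. (P s $ v $ c - P s $ w $ c)\<^sup>2)"
    unfolding power2_norm_eq_inner by (simp add: inner_vec_def power2_eq_square)
  then show ?thesis
    by (simp add: real_analytic_intros assms)
qed

lemma vec_vec_tendstoI: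
  fixes P :: "'a \<Rightarrow> real^'d^'v"
  assumes "\<And>v c. ((\<lambda>t. P t $ v $ c) \<longlongrightarrow> u $ v $ c) F"
  shows "(P \<longlongrightarrow> u) F"
proof (rule vec_tendstoI)
  show "((\<lambda>t. P t $ v) \<longlongrightarrow> u $ v) F" for v
    by (rule vec_tendstoI) (rule assms)
qed

text \<open>A nonzero limit velocity u ensures at once that the trajectory is non-constant and
  1-active, and a null quotient of the squared lengths is k-vanishing by
  \<open>tendsto_imp_vanishing\<close>. Flexes can thus be built from limits alone.\<close>

lemma is_flexI:
  fixes p :: "real^'d::{finite,linorder}^'v::{finite,linorder}"
  assumes "eps > 0" and P0: "P 0 = p"
    and pin: "\<And>t. t \<in> {0..eps} \<Longrightarrow> P t \<in> pinned_space l"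
    and an: "\<And>t v c. t \<in> {0..eps} \<Longrightarrow> real_analytic_at (\<lambda>s. P s $ v $ c) t"
    and lim_u: "((\<lambda>t. (1 / t) *\<^sub>R (P t - p)) \<longlongrightarrow> u) (at 0)" and "u \<noteq> 0"
    and lim_m: "((\<lambda>t. (1 / t ^ k) *\<^sub>R (edge_form E (P t) (P t) - edge_form E p p)) \<longlongrightarrow> 0) (at 0)"
  shows "is_flex l E p 1 k P"
proof -
  have an0: "real_analytic_at (\<lambda>s. P s $ v $ c) 0" for v c
    using an \<open>eps > 0\<close> by simp
  have nonconst: "\<exists>t\<in>{0..eps}. P t \<noteq> p"
  proof (rule ccontr)
    assume "\<not> ?thesis"
    then have "eventually (\<lambda>t. (1 / t) *\<^sub>R (P t - p) = 0) (at_right 0)"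
      using \<open>eps > 0\<close> by (auto simp: eventually_at_right_field intro!: exI[of _ eps])
    moreover have "((\<lambda>t. (1 / t) *\<^sub>R (P t - p)) \<longlongrightarrow> u) (at_right 0)"
      by (rule tendsto_mono[OF at_le lim_u]) auto
    ultimately have "u = 0"
      by (intro tendsto_unique[OF trivial_limit_at_right_real _ tendsto_eventually])
    with \<open>u \<noteq> 0\<close> show False by simp
  qed
  have "traj_active P 1"
    unfolding traj_active_def
  proof
    show "\<forall>v c. vanishing (\<lambda>t. P t $ v $ c) (1 - 1)"
      by (simp add: vanishing_def)
    show "\<not> (\<forall>v c. vanishing (\<lambda>t. P t $ v $ c) 1)"
    proof
      assume van: "\<forall>v c. vanishing (\<lambda>t. P t $ v $ c) 1"
      have "u $ v $ c = 0" for v c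
      proof -
        obtain r where r: "((\<lambda>t. (P t $ v $ c - P 0 $ v $ c) / t ^ Suc 1) \<longlongrightarrow> r) (at 0)"
          by (rule vanishing_imp_tendsto[OF an0 van[rule_format]])
        have "((\<lambda>t. t * ((P t $ v $ c - P 0 $ v $ c) / t ^ Suc 1)) \<longlongrightarrow> 0 * r) (at 0)"
          by (intro tendsto_intros r)
        then have "((\<lambda>t. ((1 / t) *\<^sub>R (P t - p)) $ v $ c) \<longlongrightarrow> 0 * r) (at 0)"
          by (rule Lim_transform_eventually) (auto simp: eventually_at_filter P0)
        moreover have "((\<lambda>t. ((1 / t) *\<^sub>R (P t - p)) $ v $ c) \<longlongrightarrow> u $ v $ c) (at 0)"
          by (intro tendsto_intros lim_u)
        ultimately have "0 * r = u $ v $ c"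
          by (rule tendsto_unique[OF at_neq_bot])
        then show ?thesis by simp
      qed
      then have "u = 0" by (simp add: vec_eq_iff)
      with \<open>u \<noteq> 0\<close> show False by simp
    qed
  qed
  moreover have "vanishing (\<lambda>t. (norm (P t $ v - P t $ w))\<^sup>2) k" if "(v, w) \<in> E" for v w
  proof (rule tendsto_imp_vanishing)
    show "real_analytic_at (\<lambda>t. (norm (P t $ v - P t $ w))\<^sup>2) 0"
      by (intro real_analytic_at_norm_diff_power2 an0)
    have "((\<lambda>t. ((1 / t ^ k) *\<^sub>R (edge_form E (P t) (P t) - edge_form E p p)) $ (v, w)) \<longlongrightarrow> 0 $ (v, w)) (at 0)"
      by (intro tendsto_intros lim_m)
    then show "((\<lambda>t. ((norm (P t $ v - P t $ w))\<^sup>2 - (norm (P 0 $ v - P 0 $ w))\<^sup>2) / t ^ k) \<longlongrightarrow> 0) (at 0)"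
      by (simp add: edge_form_self_nth that P0)
  qed
  moreover have "trajectory l p P eps"
    unfolding trajectory_def using assms nonconst by auto
  ultimately show ?thesis
    unfolding is_flex_def by auto
qed

text \<open>Translates the derivative conditions into two-sided limits: u is the velocity at 0,
  nonzero by 1-activity, and r is the coefficient of the first power that k-vanishing leaves
  free.\<close>

lemma is_flexE:
  fixes p :: "real^'d::{finite,linorder}^'v::{finite,linorder}"
  assumes "is_flex l E p 1 k P"
  obtains eps u r where "trajectory l p P eps"
    "eventually (\<lambda>t. isCont P t) (nhds 0)"
    "eventually (\<lambda>t. P t \<in> pinned_space l) (nhds 0)"
    "((\<lambda>t. (1 / t) *\<^sub>R (P t - p)) \<longlongrightarrow> u) (at 0)" "u \<noteq> 0"
    "((\<lambda>t. (1 / t ^ Suc k) *\<^sub>R (edge_form E (P t) (P t) - edge_form E p p)) \<longlongrightarrow> r) (at 0)"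
proof -
  obtain eps where traj: "trajectory l p P eps"
    and act: "traj_active P 1"
    and van: "\<And>v w. (v, w) \<in> E \<Longrightarrow> vanishing (\<lambda>t. (norm (P t $ v - P t $ w))\<^sup>2) k"
    using assms unfolding is_flex_def by auto
  have eps: "eps > 0" and P0: "P 0 = p"
    and pin: "\<And>t. t \<in> {0..eps} \<Longrightarrow> P t \<in> pinned_space l"
    and an0: "\<And>v c. real_analytic_at (\<lambda>s. P s $ v $ c) 0"
    using traj unfolding trajectory_def by auto

  have "eventually (\<lambda>t. \<forall>v c. isCont (\<lambda>s. P s $ v $ c) t) (nhds 0)"
    by (intro eventually_all_finite real_analytic_at_continuous_near an0)
  then have cont: "eventually (\<lambda>t. isCont P t) (nhds 0)"
    by eventually_elim (auto simp: isCont_def intro!: vec_vec_tendstoI)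

  \<comment> \<open>A trajectory is pinned only for t in [0, eps]. Each coordinate that pinning
    forces to 0 is analytic at 0 and vanishes to the right, hence vanishes for small negative t
    too.\<close>
  have "eventually (\<lambda>t. idx v \<le> l \<and> idx c \<ge> idx v \<longrightarrow> P t $ v $ c = 0) (nhds 0)" for v c
  proof (cases "idx v \<le> l \<and> idx c \<ge> idx v")
    case True
    then have "P t $ v $ c = 0" if "t \<in> {0..eps}" for t
      using pin[OF that] by (auto simp: pinned_space_def)
    then have "eventually (\<lambda>t. P t $ v $ c = 0) (nhds 0)"
      by (rule real_analytic_at_zero_right_imp_zero[OF an0 eps])
    then show ?thesis
      by eventually_elim auto
  qed auto
  then have "eventually (\<lambda>t. \<forall>v c. idx v \<le> l \<and> idx c \<ge> idx v \<longrightarrow> P t $ v $ c = 0) (nhds 0)"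
    by (intro eventually_all_finite)
  then have pinned: "eventually (\<lambda>t. P t \<in> pinned_space l) (nhds 0)"
    by eventually_elim (auto simp: pinned_space_def)

  have "\<exists>a. ((\<lambda>t. (P t $ v $ c - P 0 $ v $ c) / t ^ Suc 0) \<longlongrightarrow> a) (at 0)" for v c
  proof -
    have "vanishing (\<lambda>t. P t $ v $ c) 0"
      by (simp add: vanishing_def)
    from vanishing_imp_tendsto[OF an0 this] show ?thesis
      by blast
  qed
  then have "\<forall>v. \<exists>a. \<forall>c. ((\<lambda>t. (P t $ v $ c - P 0 $ v $ c) / t ^ Suc 0) \<longlongrightarrow> a c) (at 0)"
    by (intro allI choice)
  from choice[OF this] obtain a
    where a: "\<And>v c. ((\<lambda>t. (P t $ v $ c - P 0 $ v $ c) / t ^ Suc 0) \<longlongrightarrow> a v c) (at 0)"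
    by blast
  define u :: "real^'d::{finite,linorder}^'v::{finite,linorder}" where "u = (\<chi> v c. a v c)"
  have lim_u: "((\<lambda>t. (1 / t) *\<^sub>R (P t - p)) \<longlongrightarrow> u) (at 0)"
    by (rule vec_vec_tendstoI) (use a in \<open>simp add: u_def P0\<close>)
  have "u \<noteq> 0"
  proof
    assume "u = 0"
    then have "a v c = 0" for v c
      by (auto simp: u_def vec_eq_iff)
    then have "vanishing (\<lambda>t. P t $ v $ c) 1" for v c
      using a[of v c] by (intro tendsto_imp_vanishing an0) simp
    then show False
      using act by (auto simp: traj_active_def)
  qed

  have "\<exists>b. ((\<lambda>t. (edge_form E (P t) (P t) $ e - edge_form E p p $ e) / t ^ Suc k) \<longlongrightarrow> b) (at 0)" for e
  proof (cases "e \<in> E")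
    case True
    obtain v w where e: "e = (v, w)" by (cases e)
    obtain b where "((\<lambda>t. ((norm (P t $ v - P t $ w))\<^sup>2 - (norm (P 0 $ v - P 0 $ w))\<^sup>2) / t ^ Suc k) \<longlongrightarrow> b) (at 0)"
      by (rule vanishing_imp_tendsto[OF real_analytic_at_norm_diff_power2[OF an0] van[OF True[unfolded e]]])
    then show ?thesis
      using True by (auto simp: e edge_form_self_nth P0)
  next
    case False
    then show ?thesis by (auto simp: edge_form_def intro!: exI[of _ 0])
  qed
  then have "\<forall>e. \<exists>b. ((\<lambda>t. (edge_form E (P t) (P t) $ e - edge_form E p p $ e) / t ^ Suc k) \<longlongrightarrow> b) (at 0)"
    by (rule allI)
  from choice[OF this] obtain b
    where b: "\<And>e. ((\<lambda>t. (edge_form E (P t) (P t) $ e - edge_form E p p $ e) / t ^ Suc k) \<longlongrightarrow> b e) (at 0)"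
    by blast
  have "((\<lambda>t. (1 / t ^ Suc k) *\<^sub>R (edge_form E (P t) (P t) - edge_form E p p)) \<longlongrightarrow> (\<chi> e. b e)) (at 0)"
    by (rule vec_tendstoI) (use b in simp)
  with traj cont pinned lim_u \<open>u \<noteq> 0\<close> show thesis by (rule that)
qed

text \<open>Adding \<open>t ^ (k + 1) w\<close> changes the leading error coefficient \<open>r\<close> by the image of \<open>w\<close> under
  the differential of the squared edge lengths.\<close>
lemma flex_extension:
  fixes p :: "real^'d::{finite,linorder}^'v::{finite,linorder}"
  assumes traj: "trajectory l p P eps" and "k \<ge> 1"
    and lim_u: "((\<lambda>t. (1 / t) *\<^sub>R (P t - p)) \<longlongrightarrow> u) (at 0)" and "u \<noteq> 0"
    and lim_r: "((\<lambda>t. (1 / t ^ Suc k) *\<^sub>R (edge_form E (P t) (P t) - edge_form E p p)) \<longlongrightarrow> r) (at 0)"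
    and w: "w \<in> pinned_space l" and r: "r + 2 *\<^sub>R edge_form E p w = 0"
  shows "has_flex l E p 1 (Suc k)"
proof -
  interpret B: bounded_bilinear "edge_form E" by (rule bounded_bilinear_edge_form)
  have eps: "eps > 0" and P0: "P 0 = p"
    and pin: "\<And>t. t \<in> {0..eps} \<Longrightarrow> P t \<in> pinned_space l"
    and an: "\<And>t v c. t \<in> {0..eps} \<Longrightarrow> real_analytic_at (\<lambda>s. P s $ v $ c) t"
    using traj unfolding trajectory_def by auto
  define Q where "Q = (\<lambda>t. P t + t ^ Suc k *\<^sub>R w)"
  have "((\<lambda>t. (1 / t) *\<^sub>R (P t - p) + t ^ k *\<^sub>R w) \<longlongrightarrow> u + 0 ^ k *\<^sub>R w) (at 0)"
    by (intro tendsto_intros lim_u)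
  then have "((\<lambda>t. (1 / t) *\<^sub>R (Q t - p)) \<longlongrightarrow> u + 0 ^ k *\<^sub>R w) (at 0)"
    by (rule Lim_transform_eventually)
       (auto simp: eventually_at_filter Q_def scaleR_add_right scaleR_diff_right algebra_simps)
  \<comment> \<open>The correction has order k + 1 \<ge> 2, so the initial velocity is still
    u.\<close>
  then have lim_Q: "((\<lambda>t. (1 / t) *\<^sub>R (Q t - p)) \<longlongrightarrow> u) (at 0)"
    using \<open>k \<ge> 1\<close> by (simp add: power_0_left)

  have "((\<lambda>t. t *\<^sub>R ((1 / t) *\<^sub>R (P t - p)) + p) \<longlongrightarrow> 0 *\<^sub>R u + p) (at 0)"
    by (intro tendsto_intros lim_u)
  then have "(P \<longlongrightarrow> 0 *\<^sub>R u + p) (at 0)"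
    by (rule Lim_transform_eventually) (auto simp: eventually_at_filter)
  then have lim_P: "(P \<longlongrightarrow> p) (at 0)"
    by simp
  have "((\<lambda>t. (1 / t ^ Suc k) *\<^sub>R (edge_form E (P t) (P t) - edge_form E p p)
        + 2 *\<^sub>R edge_form E (P t) w + t ^ Suc k *\<^sub>R edge_form E w w)
      \<longlongrightarrow> r + 2 *\<^sub>R edge_form E p w + 0 ^ Suc k *\<^sub>R edge_form E w w) (at 0)"
    by (intro tendsto_intros B.tendsto lim_r lim_P)
  then have lim0: "((\<lambda>t. (1 / t ^ Suc k) *\<^sub>R (edge_form E (P t) (P t) - edge_form E p p)
        + 2 *\<^sub>R edge_form E (P t) w + t ^ Suc k *\<^sub>R edge_form E w w) \<longlongrightarrow> 0) (at 0)"
    using r by simp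
  have "((\<lambda>t. (1 / t ^ Suc k) *\<^sub>R (edge_form E (Q t) (Q t) - edge_form E p p)) \<longlongrightarrow> 0) (at 0)"
  proof (rule Lim_transform_eventually[OF lim0], unfold eventually_at_filter,
      intro always_eventually allI impI)
    fix t :: real assume "t \<noteq> 0"
    define s where "s = t ^ Suc k"
    have "s \<noteq> 0" using \<open>t \<noteq> 0\<close> by (simp add: s_def)
    have "edge_form E (Q t) (Q t) = edge_form E (P t) (P t) + (2 * s) *\<^sub>R edge_form E (P t) w
        + (s * s) *\<^sub>R edge_form E w w"
      unfolding Q_def s_def[symmetric]
        bounded_bilinear_square_add[OF bounded_bilinear_edge_form edge_form_commute]
      by (simp only: B.scaleR_left B.scaleR_right scaleR_scaleR)
    then have "(1 / s) *\<^sub>R (edge_form E (Q t) (Q t) - edge_form E p p)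
      = (1 / s) *\<^sub>R (edge_form E (P t) (P t) - edge_form E p p)
        + (1 / s) *\<^sub>R ((2 * s) *\<^sub>R edge_form E (P t) w) + (1 / s) *\<^sub>R ((s * s) *\<^sub>R edge_form E w w)"
      by (simp only: scaleR_add_right scaleR_diff_right add_diff_eq diff_add_eq)
    then show "(1 / t ^ Suc k) *\<^sub>R (edge_form E (P t) (P t) - edge_form E p p)
        + 2 *\<^sub>R edge_form E (P t) w + t ^ Suc k *\<^sub>R edge_form E w w
      = (1 / t ^ Suc k) *\<^sub>R (edge_form E (Q t) (Q t) - edge_form E p p)"
      unfolding s_def[symmetric] using \<open>s \<noteq> 0\<close> by simp
  qed
  moreover have "Q t \<in> pinned_space l" if "t \<in> {0..eps}" for t
    unfolding Q_def
    by (rule subspace_add[OF subspace_pinned_space pin[OF that] subspace_scale[OF subspace_pinned_space w]])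
  moreover have "real_analytic_at (\<lambda>s. Q s $ v $ c) t" if "t \<in> {0..eps}" for t v c
    unfolding Q_def vector_add_component vector_scaleR_component real_scaleR_def
    by (intro real_analytic_at_add real_analytic_at_mult real_analytic_at_power
        real_analytic_at_ident real_analytic_at_const an[OF that])
  ultimately have "is_flex l E p 1 (Suc k) Q"
    using eps lim_Q \<open>u \<noteq> 0\<close> by (intro is_flexI[where eps = eps and u = u]) (auto simp: Q_def P0)
  then show ?thesis
    unfolding has_flex_def by (rule exI[of _ Q])
qed

section \<open>Rigidity order\<close>

lemma edge_form_eq_iff_equivalent:
  "edge_form E q q = edge_form E p p \<longleftrightarrow> equivalent E p q"
proof
  assume eq: "edge_form E q q = edge_form E p p"
  have "(dist (q $ v) (q $ w))\<^sup>2 = (dist (p $ v) (p $ w))\<^sup>2" if "(v, w) \<in> E" for v w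
    using arg_cong[OF eq, of "\<lambda>m. m $ (v, w)"] that by (simp add: edge_form_self_nth dist_norm)
  then show "equivalent E p q"
    by (auto simp: equivalent_def)
next
  assume "equivalent E p q"
  then show "edge_form E q q = edge_form E p p"
    by (auto simp: equivalent_def edge_form_def vec_eq_iff dist_norm simp flip: power2_norm_eq_inner)
qed

text \<open>Applies the bilinear estimate with exponent k + 1. Its non-cancellation hypothesis is
  the contrapositive of \<open>flex_extension\<close>: a w cancelling r would produce the excluded
  flex.\<close>

lemma edge_form_growth:
  fixes p :: "real^'d::{finite,linorder}^'v::{finite,linorder}"
  assumes p: "p \<in> pinned_space l" and dimK: "dim (Kspace l E p) = 1"
    and k: "k \<ge> 1" and flex: "is_flex l E p 1 k P" and no: "\<not> has_flex l E p 1 (Suc k)"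
  obtains c where "c > 0"
    "eventually (\<lambda>q. q \<in> pinned_space l \<longrightarrow>
       c * norm (q - p) ^ Suc k \<le> norm (edge_form E q q - edge_form E p p)) (nhds p)"
proof -
  obtain eps u r where P: "trajectory l p P eps"
    "eventually (\<lambda>t. isCont P t) (nhds 0)"
    "eventually (\<lambda>t. P t \<in> pinned_space l) (nhds 0)"
    "((\<lambda>t. (1 / t) *\<^sub>R (P t - p)) \<longlongrightarrow> u) (at 0)" "u \<noteq> 0"
    "((\<lambda>t. (1 / t ^ Suc k) *\<^sub>R (edge_form E (P t) (P t) - edge_form E p p)) \<longlongrightarrow> r) (at 0)"
    using is_flexE[OF flex] .
  have P0: "P 0 = p"
    using P(1) by (simp add: trajectory_def)
  have r: "r + 2 *\<^sub>R edge_form E p w \<noteq> 0" if "w \<in> pinned_space l" for w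
    using flex_extension[OF P(1) k P(4,5,6) that] no by blast
  have P_V: "eventually (\<lambda>t. P t - p \<in> pinned_space l) (nhds 0)"
    using P(3) by eventually_elim (intro subspace_diff[OF subspace_pinned_space] p)
  have dim1: "dim {x \<in> pinned_space l. edge_form E p x = 0} = 1"
    using dimK by (simp add: Kspace_eq_edge_form_kernel)
  have k2: "2 \<le> Suc k" using k by simp
  obtain c where c: "c > 0" "eventually (\<lambda>q. q - p \<in> pinned_space l \<longrightarrow>
       c * norm (q - p) ^ Suc k \<le> norm (edge_form E q q - edge_form E p p)) (nhds p)"
    using bilinear_square_growth_along_kernel_line[OF bounded_bilinear_edge_form edge_form_commute
        subspace_pinned_space dim1 k2 P0 P(2) P_V P(4,5,6) r] .
  from c(2) have "eventually (\<lambda>q. q \<in> pinned_space l \<longrightarrow>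
       c * norm (q - p) ^ Suc k \<le> norm (edge_form E q q - edge_form E p p)) (nhds p)"
    by eventually_elim (use subspace_diff[OF subspace_pinned_space _ p] in blast)
  with c(1) show thesis by (rule that)
qed

text \<open>Quantitative form of the two limits in \<open>is_flexE\<close>, with constants
  \<open>norm u / 2\<close> and \<open>norm r + 1\<close>. It is restricted to t > 0, where powers
  of t need no absolute values.\<close>

lemma flex_growth:
  fixes p :: "real^'d::{finite,linorder}^'v::{finite,linorder}"
  assumes "is_flex l E p 1 k P"
  obtains eps a C where "trajectory l p P eps" "a > 0" "C > 0"
    "eventually (\<lambda>t. P t \<in> pinned_space l \<and> a * t \<le> norm (P t - p)
       \<and> norm (edge_form E (P t) (P t) - edge_form E p p) \<le> C * t ^ Suc k) (at_right 0)"
    "(P \<longlongrightarrow> p) (at_right 0)"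
proof -
  obtain eps u r where P: "trajectory l p P eps"
    "eventually (\<lambda>t. isCont P t) (nhds 0)"
    "eventually (\<lambda>t. P t \<in> pinned_space l) (nhds 0)"
    "((\<lambda>t. (1 / t) *\<^sub>R (P t - p)) \<longlongrightarrow> u) (at 0)" "u \<noteq> 0"
    "((\<lambda>t. (1 / t ^ Suc k) *\<^sub>R (edge_form E (P t) (P t) - edge_form E p p)) \<longlongrightarrow> r) (at 0)"
    using is_flexE[OF assms] .
  have right: "(f \<longlongrightarrow> x) (at_right 0)" if "(f \<longlongrightarrow> x) (at 0)" for f :: "real \<Rightarrow> 'c::topological_space" and x
    by (rule tendsto_mono[OF at_le that]) auto
  have "P 0 = p"
    using P(1) by (simp add: trajectory_def)
  then have "(P \<longlongrightarrow> p) (at 0)"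
    using eventually_nhds_x_imp_x[OF P(2)] by (simp add: isCont_def)
  then have "(P \<longlongrightarrow> p) (at_right 0)"
    by (rule right)
  have pin: "eventually (\<lambda>t. P t \<in> pinned_space l) (at_right 0)"
    using P(3) unfolding eventually_at_filter by eventually_elim simp
  have "eventually (\<lambda>t. norm u / 2 < norm ((1 / t) *\<^sub>R (P t - p))) (at_right 0)"
    using \<open>u \<noteq> 0\<close> by (intro order_tendstoD(1)[OF tendsto_norm[OF right[OF P(4)]]]) simp
  moreover have "eventually (\<lambda>t. norm ((1 / t ^ Suc k) *\<^sub>R (edge_form E (P t) (P t) - edge_form E p p))
      < norm r + 1) (at_right 0)"
    by (intro order_tendstoD(2)[OF tendsto_norm[OF right[OF P(6)]]]) simp
  ultimately have "eventually (\<lambda>t. P t \<in> pinned_space l \<and> norm u / 2 * t \<le> norm (P t - p)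
       \<and> norm (edge_form E (P t) (P t) - edge_form E p p) \<le> (norm r + 1) * t ^ Suc k) (at_right 0)"
    using pin eventually_at_right_less[of 0]
  proof eventually_elim
    case (elim t)
    have "t ^ Suc k > 0" using elim by simp
    have "norm (P t - p) / t > norm u / 2"
      using elim by simp
    moreover have "norm (edge_form E (P t) (P t) - edge_form E p p) / t ^ Suc k < norm r + 1"
      using elim(2) \<open>t ^ Suc k > 0\<close> by (simp del: power_Suc)
    ultimately show ?case
      using elim \<open>t ^ Suc k > 0\<close> by (simp add: pos_less_divide_eq pos_divide_less_eq del: power_Suc)
  qed
  moreover have "norm u / 2 > 0" "norm r + 1 > 0"
    using \<open>u \<noteq> 0\<close> by (simp_all add: add_nonneg_pos)
  ultimately show thesis
    using that[OF P(1)] \<open>(P \<longlongrightarrow> p) (at_right 0)\<close> by blast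
qed

lemma flex_energy_growth:
  fixes p :: "real^'d::{finite,linorder}^'v::{finite,linorder}"
  assumes "framework E p" "stiff_bar E p F" and "is_flex l E p 1 k P"
  obtains eps a C where "trajectory l p P eps" "a > 0" "C > 0"
    "eventually (\<lambda>t. P t \<in> pinned_space l \<and> a * t \<le> norm (P t - p)
       \<and> energy E F (P t) - energy E F p \<le> C * t ^ (2 * Suc k)) (at_right 0)"
    "(P \<longlongrightarrow> p) (at_right 0)"
proof -
  obtain c C where cC: "c > 0" "C > 0" and comp:
    "eventually (\<lambda>q. c * (norm (edge_form E q q - edge_form E p p))\<^sup>2 \<le> energy E F q - energy E F p
       \<and> energy E F q - energy E F p \<le> C * (norm (edge_form E q q - edge_form E p p))\<^sup>2) (nhds p)"
    using stiff_bar_energy_comparable[OF assms(1,2)] .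
  obtain eps a C' where P: "trajectory l p P eps" "a > 0" "C' > 0"
    "eventually (\<lambda>t. P t \<in> pinned_space l \<and> a * t \<le> norm (P t - p)
       \<and> norm (edge_form E (P t) (P t) - edge_form E p p) \<le> C' * t ^ Suc k) (at_right 0)"
    "(P \<longlongrightarrow> p) (at_right 0)"
    using flex_growth[OF assms(3)] .
  from P(4) eventually_compose_filterlim[OF comp P(5)]
  have "eventually (\<lambda>t. P t \<in> pinned_space l \<and> a * t \<le> norm (P t - p)
       \<and> energy E F (P t) - energy E F p \<le> (C * C'\<^sup>2) * t ^ (2 * Suc k)) (at_right 0)"
  proof eventually_elim
    case (elim t)
    have "(norm (edge_form E (P t) (P t) - edge_form E p p))\<^sup>2 \<le> (C' * t ^ Suc k)\<^sup>2"
      using elim by (intro power_mono) auto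
    also have "\<dots> = C'\<^sup>2 * t ^ (2 * Suc k)"
      by (simp add: power_mult_distrib power_mult[symmetric] mult.commute del: power_Suc mult_Suc mult_Suc_right)
    finally have "C * (norm (edge_form E (P t) (P t) - edge_form E p p))\<^sup>2 \<le> C * (C'\<^sup>2 * t ^ (2 * Suc k))"
      using cC by (intro mult_left_mono) auto
    then show ?case
      using elim by (simp add: mult.assoc)
  qed
  with P(1,2) cC P(3,5) show thesis
    by (intro that[of eps a "C * C'\<^sup>2"]) auto
qed

text \<open>A rigidity order is a statement about all stiff-bar energies, so bounding it from below
  needs one concrete energy; springs at rest length serve.\<close>

lemma stiff_bar_quadratic:
  assumes "framework E p"
  shows "stiff_bar E p (\<lambda>e x. (x - dist (p $ fst e) (p $ snd e))\<^sup>2)"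
proof -
  have "deriv (\<lambda>x. (x - d)\<^sup>2) = (\<lambda>x. 2 * (x - d))" for d :: real
    by (rule ext) (auto intro!: DERIV_imp_deriv derivative_eq_intros)
  moreover have "deriv (\<lambda>x. 2 * (x - d)) x = 2" for d x :: real
    by (auto intro!: DERIV_imp_deriv derivative_eq_intros)
  ultimately have "(deriv ^^ 2) (\<lambda>x. (x - d)\<^sup>2) d = 2" for d :: real
    by (simp add: eval_nat_numeral)
  moreover have "real_analytic_at (\<lambda>x. (x - d)\<^sup>2) x" for d x :: real
    by (intro real_analytic_intros)
  ultimately show ?thesis
    unfolding stiff_bar_def by (auto simp: Let_def intro: exI[of _ 1])
qed

text \<open>If \<nu> < n, dividing by \<open>t powr \<nu>\<close> bounds c by
  \<open>C * t powr (real n - \<nu>)\<close>, which tends to 0 from the right, contradicting c >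
  0.\<close>

lemma power_le_imp_exponent_ge:
  fixes \<nu> :: real
  assumes "c > 0" and "eventually (\<lambda>t. c * t powr \<nu> \<le> C * t ^ n) (at_right 0)"
  shows "\<nu> \<ge> real n"
proof (rule ccontr)
  assume "\<not> ?thesis"
  then have "((\<lambda>t. C * t powr (real n - \<nu>)) \<longlongrightarrow> C * 0) (at_right 0)"
    by (intro tendsto_intros tendsto_zero_powrI[where b = "real n - \<nu>"])
       (auto simp: eventually_at_right_field intro!: exI[of _ 1] tendsto_ident_at)
  then have "eventually (\<lambda>t. C * t powr (real n - \<nu>) < c) (at_right 0)"
    using \<open>c > 0\<close> by (auto dest: order_tendstoD(2))
  with assms(2) have "eventually (\<lambda>t::real. False) (at_right 0)"
    using eventually_at_right_less[of 0]
  proof eventually_elim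
    case (elim t)
    have "C * t ^ n = C * t powr (real n - \<nu>) * t powr \<nu>"
      using elim by (simp add: powr_realpow[symmetric] powr_add[symmetric])
    also have "\<dots> < c * t powr \<nu>"
      using elim by (intro mult_strict_right_mono) auto
    finally show False using elim by simp
  qed
  then show False by simp
qed

theorem theorem5p3:
  fixes p :: "real^'d::{finite,linorder}^'v::{finite,linorder}"
    and E :: "('v \<times> 'v) set" and l k :: nat
  assumes "framework E p"
    and "pinned l p"
    and "dim (Kspace l E p) = 1"
    and "k \<ge> 2"
    and "has_flex l E p 1 (k - 1)"
  shows "(\<not> has_flex l E p 1 k \<longrightarrow> rigid l E p \<and> has_rigidity_order l E p (real k))
    \<and> (has_flex l E p 1 k \<longrightarrow>
         \<not> rigid l E p \<or>
         (rigid l E p \<and> (\<forall>\<nu>. has_rigidity_order l E p \<nu> \<longrightarrow> \<nu> \<ge> real k + 1)))"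
proof (intro conjI impI)
  assume no: "\<not> has_flex l E p 1 k"
  have p: "p \<in> pinned_space l"
    using assms(2) by (simp add: pinned_def)
  obtain P where P: "is_flex l E p 1 (k - 1) P"
    using assms(5) by (auto simp: has_flex_def)
  have Suc: "Suc (k - 1) = k" and k1: "k - 1 \<ge> 1"
    using assms(4) by auto
  obtain c where c: "c > 0" "eventually (\<lambda>q. q \<in> pinned_space l \<longrightarrow>
       c * norm (q - p) ^ k \<le> norm (edge_form E q q - edge_form E p p)) (nhds p)"
    using edge_form_growth[OF p assms(3) k1 P] no unfolding Suc by blast
  \<comment> \<open>For an equivalent configuration the right side of the growth bound is 0, which
    forces q = p.\<close>
  show rigid: "rigid l E p"
  proof -
    have "eventually (\<lambda>q. q \<in> pinned_space l \<longrightarrow> equivalent E p q \<longrightarrow> q = p) (nhds p)"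
      using c(2)
    proof eventually_elim
      case (elim q)
      show ?case
      proof (intro impI)
        assume "q \<in> pinned_space l" "equivalent E p q"
        then have "c * norm (q - p) ^ k \<le> 0"
          using elim by (simp flip: edge_form_eq_iff_equivalent)
        then have "norm (q - p) ^ k \<le> 0"
          using c(1) by (simp add: mult_le_0_iff)
        then show "q = p"
          by (metis norm_ge_zero zero_le_power order_antisym power_eq_0_iff norm_eq_zero right_minus_eq)
      qed
    qed
    then show ?thesis
      unfolding rigid_def eventually_nhds by blast
  qed
  have "tight_growth l (energy E F) p (2 * real k)" if F: "stiff_bar E p F" for F
  proof -
    obtain c' C' where cC: "c' > 0" "C' > 0" and comp:
      "eventually (\<lambda>q. c' * (norm (edge_form E q q - edge_form E p p))\<^sup>2 \<le> energy E F q - energy E F p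
       \<and> energy E F q - energy E F p \<le> C' * (norm (edge_form E q q - edge_form E p p))\<^sup>2) (nhds p)"
      using stiff_bar_energy_comparable[OF assms(1) F] .
    \<comment> \<open>\<open>powr\<close> agrees with the natural power for a positive base; at q =
      p both sides are 0 because k > 0.\<close>
    have norm_powr: "norm (q - p) powr (2 * real k) = (norm (q - p) ^ k)\<^sup>2" for q :: "real^'d::{finite,linorder}^'v::{finite,linorder}"
    proof (cases "q = p")
      case False
      have "norm (q - p) powr real (k * 2) = norm (q - p) ^ (k * 2)"
        using False by (intro powr_realpow) simp
      then show ?thesis
        by (simp add: mult.commute power_mult)
    qed (use assms(4) in simp)
    \<comment> \<open>The energy compares with the square of the edge-length defect, so the exponent
      k of the defect becomes 2k.\<close>
    have "eventually (\<lambda>q. q \<in> pinned_space l \<longrightarrow>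
        c' * c\<^sup>2 * norm (q - p) powr (2 * real k) \<le> energy E F q - energy E F p) (nhds p)"
      using c(2) comp
    proof eventually_elim
      case (elim q)
      show ?case
      proof
        assume "q \<in> pinned_space l"
        then have "(c * norm (q - p) ^ k)\<^sup>2 \<le> (norm (edge_form E q q - edge_form E p p))\<^sup>2"
          using elim c(1) by (intro power_mono) auto
        then have "c' * (c * norm (q - p) ^ k)\<^sup>2 \<le> c' * (norm (edge_form E q q - edge_form E p p))\<^sup>2"
          using cC by (intro mult_left_mono) auto
        then show "c' * c\<^sup>2 * norm (q - p) powr (2 * real k) \<le> energy E F q - energy E F p"
          using elim unfolding norm_powr by (simp add: power_mult_distrib mult.assoc)
      qed
    qed
    then have quick: "always_quick l (energy E F) p (2 * real k)"
      using cC(1) c(1) unfolding always_quick_def eventually_nhds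
      by (intro exI[of _ "c' * c\<^sup>2"] conjI) auto
    have "local_min_at l (energy E F) p"
    proof -
      have "eventually (\<lambda>q. energy E F p \<le> energy E F q) (nhds p)"
        using comp
      proof eventually_elim
        case (elim q)
        have "0 \<le> c' * (norm (edge_form E q q - edge_form E p p))\<^sup>2"
          using cC by simp
        then show ?case using elim by linarith
      qed
      then show ?thesis
        unfolding local_min_at_def eventually_nhds by blast
    qed
    moreover have "sometimes_slow l (energy E F) p (2 * real k)"
    proof -
      obtain eps a C where P': "trajectory l p P eps" "a > 0" "C > 0"
        "eventually (\<lambda>t. P t \<in> pinned_space l \<and> a * t \<le> norm (P t - p)
           \<and> energy E F (P t) - energy E F p \<le> C * t ^ (2 * k)) (at_right 0)"
        using flex_energy_growth[OF assms(1) F P] unfolding Suc .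
      then obtain b where b: "b > 0" "\<And>t. 0 < t \<Longrightarrow> t < b \<Longrightarrow> a * t \<le> norm (P t - p)
           \<and> energy E F (P t) - energy E F p \<le> C * t ^ (2 * k)"
        unfolding eventually_at_right_field by auto
      have eps: "eps > 0" and P0: "P 0 = p"
        using P'(1) by (auto simp: trajectory_def)
      \<comment> \<open>From \<open>a * t \<le> norm (P t - p)\<close>, the power
        \<open>t ^ (2 * k)\<close> is at most
        \<open>norm (P t - p) ^ (2 * k) / a ^ (2 * k)\<close>.\<close>
      define c2 where "c2 = C / a ^ (2 * k)"
      have "energy E F (P t) - energy E F p \<le> c2 * norm (P t - p) powr (2 * real k)"
        if t: "0 \<le> t" "t < b" for t
      proof (cases "t = 0")
        case False
        then have "(a * t) ^ (2 * k) \<le> norm (P t - p) ^ (2 * k)"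
          using b(2)[of t] t P'(2) by (intro power_mono) auto
        then have "C * t ^ (2 * k) \<le> c2 * norm (P t - p) ^ (2 * k)"
          using P'(2,3) mult_left_mono[of "(a * t) ^ (2 * k)" _ c2]
          by (simp add: c2_def power_mult_distrib)
        then show ?thesis
          using b(2)[of t] t False unfolding norm_powr by (simp add: power_mult[symmetric] mult.commute)
      qed (simp add: P0)
      \<comment> \<open>The time bound is \<open>min eps (b / 2)\<close>: it must not exceed eps,
        and its closed interval must stay strictly below b.\<close>
      then show ?thesis
        unfolding sometimes_slow_def using P'(1,2,3) eps b(1)
        by (intro exI[of _ P] exI[of _ eps] conjI exI[of _ c2] exI[of _ "min eps (b / 2)"])
           (auto simp: c2_def)
    qed
    ultimately show ?thesis
      using quick assms(4) by (simp add: tight_growth_def)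
  qed
  with rigid show "has_rigidity_order l E p (real k)"
    by (simp add: has_rigidity_order_def)
next
  assume "has_flex l E p 1 k"
  then obtain P where P: "is_flex l E p 1 k P"
    by (auto simp: has_flex_def)
  have "\<nu> \<ge> real k + 1" if \<nu>: "has_rigidity_order l E p \<nu>" for \<nu>
  proof -
    define F where "F = (\<lambda>e x. (x - dist (p $ fst e) (p $ snd e))\<^sup>2)"
    have F: "stiff_bar E p F"
      unfolding F_def by (rule stiff_bar_quadratic[OF assms(1)])
    then have "\<nu> > 0" and "always_quick l (energy E F) p (2 * \<nu>)"
      using \<nu> by (auto simp: has_rigidity_order_def tight_growth_def)
    then obtain c where c: "c > 0" "eventually (\<lambda>q. q \<in> pinned_space l \<longrightarrow>
        c * norm (q - p) powr (2 * \<nu>) \<le> energy E F q - energy E F p) (nhds p)"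
      unfolding always_quick_def eventually_nhds by blast
    obtain eps a C where P': "trajectory l p P eps" "a > 0" "C > 0"
        "eventually (\<lambda>t. P t \<in> pinned_space l \<and> a * t \<le> norm (P t - p)
           \<and> energy E F (P t) - energy E F p \<le> C * t ^ (2 * Suc k)) (at_right 0)"
        "(P \<longlongrightarrow> p) (at_right 0)"
      using flex_energy_growth[OF assms(1) F P] .
    \<comment> \<open>Along the flex, quick growth bounds the energy below by order 2\<nu> in t,
      while the flex bounds it above by order 2(k + 1). Comparing exponents as t decreases to 0
      gives \<nu> \<ge> k + 1.\<close>
    have "eventually (\<lambda>t. c * a powr (2 * \<nu>) * t powr (2 * \<nu>) \<le> C * t ^ (2 * Suc k)) (at_right 0)"
      using P'(4) eventually_compose_filterlim[OF c(2) P'(5)] eventually_at_right_less[of 0]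
    proof eventually_elim
      case (elim t)
      have "c * a powr (2 * \<nu>) * t powr (2 * \<nu>) = c * (a * t) powr (2 * \<nu>)"
        using P'(2) elim by (simp add: powr_mult)
      also have "\<dots> \<le> c * norm (P t - p) powr (2 * \<nu>)"
        using P'(2) elim c(1) \<open>\<nu> > 0\<close> by (intro mult_left_mono powr_mono2) auto
      also have "\<dots> \<le> C * t ^ (2 * Suc k)"
        using elim by linarith
      finally show ?case .
    qed
    from power_le_imp_exponent_ge[OF _ this] c(1) P'(2) have "2 * \<nu> \<ge> real (2 * Suc k)"
      by simp
    then show ?thesis by simp
  qed
  then show "\<not> rigid l E p \<or>
         (rigid l E p \<and> (\<forall>\<nu>. has_rigidity_order l E p \<nu> \<longrightarrow> \<nu> \<ge> real k + 1))"
    by blast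
qed

end
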